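(* Let $\mathfrak{A}$ be a $C^*$-algebra, let $H,K$ be Hilbert $\mathfrak{A}$-modules, and let $T\in\mathcal{L}(H,K)$. Then the following statements are equivalent: (i) $\overline{\mathcal{R}(T)}$ and $\overline{\mathcal{R}(T^* )}$ are both orthogonally complemented; (ii) $\overline{\mathcal{R}(T^* )}$ is orthogonally complemented and there is a partial isometry $U\in\mathcal{L}(H,K)$ such that $T=U|T|$ and $U^*U=P_{\overline{\mathcal{R}(T^* )}}$; (iii) $\overline{\mathcal{R}(T^* )}$ is orthogonally complemented, $\mathcal{R}(|T|)=\mathcal{R}(T^* )$ and $\mathcal{R}(|T^*|)=\mathcal{R}(T)$.
   Context: $\mathcal{L}(H,K)$ denotes the set of adjointable operators from $H$ to $K$, i.e. maps $T:H\to K$ for which there is $T^*:K\to H$ with $\langle Tx,y\rangle=\langle x,T^*y\rangle$ for all $x\in H$, $y\in K$. $\mathcal{R}(T)$ is the range of $T$; the bar denotes norm closure. A closed submodule $M$ of a Hilbert $\mathfrak{A}$-module $E$ is orthogonally complemented if $E=M\dotplus M^\perp$, where $M^\perp=\{x\in E:\langle x,y\rangle=0 \text{ for all } y\in M\}$; in that case $P_M$ denotes the projection from $E$ onto $M$ along $M^\perp$. An operator $U\in\mathcal{L}(H,K)$ is a partial isometry if $U^*U$ is a projection in $\mathcal{L}(H)$. For $T\in\mathcal{L}(H,K)$, $|T|=(T^*T)^{1/2}$ and $|T^*|=(TT^* )^{1/2}$. *)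

theory Defs
  imports "HOL-Analysis.Analysis"
begin

class complex_banach = banach +
  fixes scaleC :: "complex \<Rightarrow> 'a \<Rightarrow> 'a"  (infixr \<open>*\<^sub>C\<close> 75)
  assumes scaleC_add_right: "c *\<^sub>C (x + y) = c *\<^sub>C x + c *\<^sub>C y"
    and scaleC_add_left: "(c + d) *\<^sub>C x = c *\<^sub>C x + d *\<^sub>C x"
    and scaleC_scaleC: "c *\<^sub>C d *\<^sub>C x = (c * d) *\<^sub>C x"
    and scaleC_of_real: "complex_of_real r *\<^sub>C x = r *\<^sub>R x"
    and norm_scaleC: "norm (c *\<^sub>C x) = cmod c * norm x"

text \<open>No unit is assumed: \<^class>\<open>real_normed_algebra\<close> is the class of possibly non-unital
  normed algebras.\<close>

class cstar_algebra = complex_banach + real_normed_algebra +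
  fixes star :: "'a \<Rightarrow> 'a"
  assumes scaleC_mult_left: "(c *\<^sub>C a) * b = c *\<^sub>C (a * b)"
    and scaleC_mult_right: "a * (c *\<^sub>C b) = c *\<^sub>C (a * b)"
    and star_add: "star (a + b) = star a + star b"
    and star_scaleC: "star (c *\<^sub>C a) = cnj c *\<^sub>C star a"
    and star_mult: "star (a * b) = star b * star a"
    and star_star: "star (star a) = a"
    and cstar_identity: "norm (star a * a) = (norm a)\<^sup>2"

definition cstar_positive :: "'a::cstar_algebra \<Rightarrow> bool" where
  "cstar_positive a \<longleftrightarrow> (\<exists>b. a = star b * b)"

text \<open>Right modules; the inner product is linear in its second argument. Completeness in the
  norm induced by the inner product is expressed by \<open>norm_eq_ip\<close> together with the completeness
  of the type \<open>'h\<close> in its norm.\<close>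

locale hilbert_module =
  fixes act :: "'h::complex_banach \<Rightarrow> 'a::cstar_algebra \<Rightarrow> 'h"
    and ip :: "'h \<Rightarrow> 'h \<Rightarrow> 'a"
  assumes act_add_left: "act (x + y) a = act x a + act y a"
    and act_add_right: "act x (a + b) = act x a + act x b"
    and act_act: "act (act x a) b = act x (a * b)"
    and act_scaleC_left: "act (c *\<^sub>C x) a = c *\<^sub>C act x a"
    and act_scaleC_right: "act x (c *\<^sub>C a) = c *\<^sub>C act x a"
    and ip_add_right: "ip x (y + z) = ip x y + ip x z"
    and ip_scaleC_right: "ip x (c *\<^sub>C y) = c *\<^sub>C ip x y"
    and ip_act_right: "ip x (act y a) = ip x y * a"
    and star_ip: "star (ip x y) = ip y x"
    and ip_positive: "cstar_positive (ip x x)"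
    and ip_definite: "ip x x = 0 \<Longrightarrow> x = 0"
    and norm_eq_ip: "norm x = sqrt (norm (ip x x))"

definition adjointable :: "('h \<Rightarrow> 'h \<Rightarrow> 'a) \<Rightarrow> ('k \<Rightarrow> 'k \<Rightarrow> 'a) \<Rightarrow> ('h \<Rightarrow> 'k) set" where
  "adjointable ipH ipK = {T. \<exists>S. \<forall>x y. ipK (T x) y = ipH x (S y)}"

definition adj :: "('h \<Rightarrow> 'h \<Rightarrow> 'a) \<Rightarrow> ('k \<Rightarrow> 'k \<Rightarrow> 'a) \<Rightarrow> ('h \<Rightarrow> 'k) \<Rightarrow> 'k \<Rightarrow> 'h" where
  "adj ipH ipK T = (THE S. \<forall>x y. ipK (T x) y = ipH x (S y))"

definition closed_submodule :: "('h::complex_banach \<Rightarrow> 'a \<Rightarrow> 'h) \<Rightarrow> 'h set \<Rightarrow> bool" where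
  "closed_submodule act M \<longleftrightarrow> closed M \<and> 0 \<in> M \<and>
     (\<forall>x\<in>M. \<forall>y\<in>M. x + y \<in> M) \<and> (\<forall>c. \<forall>x\<in>M. c *\<^sub>C x \<in> M) \<and> (\<forall>x\<in>M. \<forall>a. act x a \<in> M)"

definition orth_compl :: "('h \<Rightarrow> 'h \<Rightarrow> 'a::zero) \<Rightarrow> 'h set \<Rightarrow> 'h set" where
  "orth_compl ip M = {x. \<forall>y\<in>M. ip x y = 0}"

definition orthogonally_complemented ::
    "('h::complex_banach \<Rightarrow> 'a \<Rightarrow> 'h) \<Rightarrow> ('h \<Rightarrow> 'h \<Rightarrow> 'a::zero) \<Rightarrow> 'h set \<Rightarrow> bool" where
  "orthogonally_complemented act ip M \<longleftrightarrow> closed_submodule act M \<and>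
     M \<inter> orth_compl ip M = {0} \<and> (\<forall>x. \<exists>m\<in>M. \<exists>n\<in>orth_compl ip M. x = m + n)"

definition proj_onto :: "('h::ab_group_add \<Rightarrow> 'h \<Rightarrow> 'a::zero) \<Rightarrow> 'h set \<Rightarrow> 'h \<Rightarrow> 'h" where
  "proj_onto ip M x = (THE m. m \<in> M \<and> x - m \<in> orth_compl ip M)"

definition is_projection :: "('h \<Rightarrow> 'h \<Rightarrow> 'a) \<Rightarrow> ('h \<Rightarrow> 'h) \<Rightarrow> bool" where
  "is_projection ip P \<longleftrightarrow> P \<in> adjointable ip ip \<and> P \<circ> P = P \<and> adj ip ip P = P"

definition partial_isometry ::
    "('h \<Rightarrow> 'h \<Rightarrow> 'a) \<Rightarrow> ('k \<Rightarrow> 'k \<Rightarrow> 'a) \<Rightarrow> ('h \<Rightarrow> 'k) \<Rightarrow> bool" where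
  "partial_isometry ipH ipK U \<longleftrightarrow>
     U \<in> adjointable ipH ipK \<and> is_projection ipH (adj ipH ipK U \<circ> U)"

text \<open>Positivity in the C*-algebra of adjointable operators, in the same sense as
  \<^const>\<open>cstar_positive\<close>; the square root is the unique positive one.\<close>

definition op_positive :: "('h \<Rightarrow> 'h \<Rightarrow> 'a) \<Rightarrow> ('h \<Rightarrow> 'h) \<Rightarrow> bool" where
  "op_positive ip S \<longleftrightarrow> (\<exists>R\<in>adjointable ip ip. S = adj ip ip R \<circ> R)"

definition op_sqrt :: "('h \<Rightarrow> 'h \<Rightarrow> 'a) \<Rightarrow> ('h \<Rightarrow> 'h) \<Rightarrow> 'h \<Rightarrow> 'h" where
  "op_sqrt ip A = (THE S. op_positive ip S \<and> S \<circ> S = A)"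

definition abs_op :: "('h \<Rightarrow> 'h \<Rightarrow> 'a) \<Rightarrow> ('k \<Rightarrow> 'k \<Rightarrow> 'a) \<Rightarrow> ('h \<Rightarrow> 'k) \<Rightarrow> 'h \<Rightarrow> 'h" where
  "abs_op ipH ipK T = op_sqrt ipH (adj ipH ipK T \<circ> T)"

definition abs_adj_op :: "('h \<Rightarrow> 'h \<Rightarrow> 'a) \<Rightarrow> ('k \<Rightarrow> 'k \<Rightarrow> 'a) \<Rightarrow> ('h \<Rightarrow> 'k) \<Rightarrow> 'k \<Rightarrow> 'k" where
  "abs_adj_op ipH ipK T = op_sqrt ipK (T \<circ> adj ipH ipK T)"

end

theory Submission
  imports Defs
begin

text \<open>
  Write \<open>S = |T|\<close>. The operators \<open>r\<^sub>n = \<Sum>\<^bsub>k<n\<^esub> (1 - S/t)\<^sup>k / t\<close> with \<open>t > \<parallel>S\<parallel>\<close> approximate the inverse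
  of \<open>S\<close>: one has \<open>S r\<^sub>n = 1 - (1 - S/t)\<^sup>n\<close>, which tends strongly to the projection onto the closure of
  \<open>\<R>(S)\<close>, equal to that of \<open>\<R>(T\<^sup>*)\<close>, once this closure is complemented. Since \<open>\<parallel>T x\<parallel> = \<parallel>S x\<parallel>\<close>, the
  sequence \<open>T r\<^sub>n\<close> then converges strongly to some \<open>U\<close>, and \<open>U\<close> is adjointable as soon as \<open>r\<^sub>n T\<^sup>*\<close>
  converges strongly too. On \<open>\<R>(T)\<close> and on \<open>ker T\<^sup>*\<close> this always happens, which gives (i) \<open>\<Rightarrow>\<close> (ii); and
  it happens everywhere if \<open>\<R>(T\<^sup>*) \<subseteq> \<R>(S)\<close>, which gives (iii) \<open>\<Rightarrow>\<close> (ii). Conversely \<open>U U\<^sup>*\<close> projects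
  onto the closure of \<open>\<R>(T)\<close>, and \<open>|T\<^sup>*| = U S U\<^sup>* = T U\<^sup>*\<close>.

  Positivity is handled without spectra: a self-adjoint \<open>h\<close> is positive iff \<open>\<parallel>t - h\<parallel> \<le> t\<close> for some
  \<open>t \<ge> 0\<close>, and square roots come from the fixed-point iteration \<open>y \<mapsto> (x + y\<^sup>2) / 2\<close>. A possibly
  non-unital C*-algebra is treated through its left multiplications on itself.
\<close>

section \<open>Bounded endomorphisms as an algebra\<close>

text \<open>Composition is a multiplication only when source and target agree, a constraint that a
  class instance for the two-parameter type of bounded linear maps cannot express. The copy has a
  single type parameter.\<close>

typedef (overloaded) 'a endo = "UNIV :: ('a::real_normed_vector \<Rightarrow>\<^sub>L 'a) set"
  morphisms blinfun_of_endo Endo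
  by simp

setup_lifting type_definition_endo

lift_definition endo_app :: "'a::real_normed_vector endo \<Rightarrow> 'a \<Rightarrow> 'a" is blinfun_apply .

instantiation endo :: (real_normed_vector) real_normed_vector
begin

lift_definition norm_endo :: "'a endo \<Rightarrow> real" is norm .
lift_definition minus_endo :: "'a endo \<Rightarrow> 'a endo \<Rightarrow> 'a endo" is minus .
lift_definition plus_endo :: "'a endo \<Rightarrow> 'a endo \<Rightarrow> 'a endo" is plus .
lift_definition uminus_endo :: "'a endo \<Rightarrow> 'a endo" is uminus .
lift_definition zero_endo :: "'a endo" is 0 .
lift_definition scaleR_endo :: "real \<Rightarrow> 'a endo \<Rightarrow> 'a endo" is scaleR .

definition dist_endo :: "'a endo \<Rightarrow> 'a endo \<Rightarrow> real"
  where "dist_endo a b = norm (a - b)"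

definition "(uniformity :: ('a endo \<times> 'a endo) filter) =
  (INF e\<in>{0 <..}. principal {(x, y). dist x y < e})"

definition open_endo :: "'a endo set \<Rightarrow> bool"
  where "open_endo S = (\<forall>x\<in>S. \<forall>\<^sub>F (x', y) in uniformity. x' = x \<longrightarrow> y \<in> S)"

definition sgn_endo :: "'a endo \<Rightarrow> 'a endo"
  where "sgn_endo x = scaleR (inverse (norm x)) x"

instance
  apply standard
  unfolding dist_endo_def open_endo_def sgn_endo_def uniformity_endo_def
  apply (rule refl | (transfer, force simp: norm_triangle_ineq algebra_simps))+
  done

end

instantiation endo :: (real_normed_vector) "{real_normed_algebra, monoid_mult}"
begin

lift_definition times_endo :: "'a endo \<Rightarrow> 'a endo \<Rightarrow> 'a endo" is blinfun_compose .
lift_definition one_endo :: "'a endo" is id_blinfun .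

instance
proof
  fix a b c :: "'a endo" and r :: real
  show "a * b * c = a * (b * c)"
    by transfer (rule blinfun_eqI, simp)
  show "(a + b) * c = a * c + b * c" "a * (b + c) = a * b + a * c"
    by (transfer, rule blinfun_eqI, simp add: blinfun.bilinear_simps)+
  show "(r *\<^sub>R a) * b = r *\<^sub>R (a * b)" "a * (r *\<^sub>R b) = r *\<^sub>R (a * b)"
    by (transfer, rule blinfun_eqI, simp add: blinfun.bilinear_simps)+
  show "1 * a = a" "a * 1 = a"
    by (transfer, rule blinfun_eqI, simp)+
  show "norm (a * b) \<le> norm a * norm b"
    by transfer (rule norm_blinfun_compose)
qed

end

instance endo :: (banach) banach
proof
  fix X :: "nat \<Rightarrow> 'a endo"
  assume "Cauchy X"
  then have "Cauchy (\<lambda>n. blinfun_of_endo (X n))"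
    by (simp add: Cauchy_def dist_norm minus_endo.rep_eq norm_endo.rep_eq)
  then obtain L where "(\<lambda>n. blinfun_of_endo (X n)) \<longlonglongrightarrow> L"
    using Cauchy_convergent convergent_def by blast
  then have "X \<longlonglongrightarrow> Endo L"
    by (simp add: LIMSEQ_def dist_norm minus_endo.rep_eq norm_endo.rep_eq Endo_inverse)
  then show "convergent X"
    by (rule convergentI)
qed

lemma endo_app_simps [simp]:
  "endo_app (f + g) x = endo_app f x + endo_app g x"
  "endo_app (f - g) x = endo_app f x - endo_app g x"
  "endo_app (- f) x = - endo_app f x"
  "endo_app (r *\<^sub>R f) x = r *\<^sub>R endo_app f x"
  "endo_app (f * g) x = endo_app f (endo_app g x)"
  "endo_app 1 x = x"
  "endo_app 0 x = 0"
  by (transfer, simp add: blinfun.bilinear_simps)+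

lemma bounded_linear_endo_app: "bounded_linear (endo_app f)"
  by transfer (rule blinfun.bounded_linear_right)

lemma endo_app_linear:
  "endo_app f (x + y) = endo_app f x + endo_app f y"
  "endo_app f (x - y) = endo_app f x - endo_app f y"
  "endo_app f (- x) = - endo_app f x"
  "endo_app f (r *\<^sub>R x) = r *\<^sub>R endo_app f x"
  "endo_app f 0 = 0"
  by (transfer, simp add: blinfun.bilinear_simps)+

lemma endo_eqI: "(\<And>x. endo_app f x = endo_app g x) \<Longrightarrow> f = g"
  by transfer (rule blinfun_eqI)

lemma norm_endo_app: "norm (endo_app f x) \<le> norm f * norm x"
  by transfer (rule norm_blinfun)

lemma norm_endo_bound: "0 \<le> b \<Longrightarrow> (\<And>x. norm (endo_app f x) \<le> b * norm x) \<Longrightarrow> norm f \<le> b"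
  by transfer (rule norm_blinfun_bound)

definition endo_of :: "('a::real_normed_vector \<Rightarrow> 'a) \<Rightarrow> 'a endo" where
  "endo_of f = Endo (Blinfun f)"

lemma endo_app_endo_of [simp]: "bounded_linear f \<Longrightarrow> endo_app (endo_of f) = f"
  by (simp add: endo_of_def endo_app.rep_eq Endo_inverse bounded_linear_Blinfun_apply)

lemma tendsto_endo_app:
  assumes "X \<longlonglongrightarrow> f" shows "(\<lambda>n. endo_app (X n) x) \<longlonglongrightarrow> endo_app f x"
proof (rule LIM_zero_cancel, rule Lim_null_comparison)
  show "\<forall>\<^sub>F n in sequentially. norm (endo_app (X n) x - endo_app f x) \<le> norm (X n - f) * norm x"
    by (intro always_eventually allI) (metis endo_app_simps(2) norm_endo_app)
  show "(\<lambda>n. norm (X n - f) * norm x) \<longlonglongrightarrow> 0"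
    using tendsto_mult_right[OF tendsto_norm[OF LIM_zero[OF assms]], of "norm x"] by simp
qed

section \<open>Positive elements of a unital C*-algebra\<close>

text \<open>The adjoint is a relation, so that the same development covers the endomorphisms of any Hilbert
  module; \<open>J\<close> stands for multiplication by the imaginary unit. The class \<open>monoid_mult\<close> replaces
  \<open>ring_1\<close> because \<open>1 = 0\<close> holds on the zero module.\<close>

locale star_relation =
  fixes isadj :: "'b::{real_normed_algebra,monoid_mult,banach} \<Rightarrow> 'b \<Rightarrow> bool"
    and J :: 'b
  assumes isadj_sym: "isadj a b \<Longrightarrow> isadj b a"
    and isadj_add: "isadj a a' \<Longrightarrow> isadj b b' \<Longrightarrow> isadj (a + b) (a' + b')"
    and isadj_scaleR: "isadj a a' \<Longrightarrow> isadj (r *\<^sub>R a) (r *\<^sub>R a')"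
    and isadj_mult: "isadj a a' \<Longrightarrow> isadj b b' \<Longrightarrow> isadj (a * b) (b' * a')"
    and isadj_one: "isadj 1 1"
    and isadj_limit: "(\<And>n. isadj (X n) (X n)) \<Longrightarrow> X \<longlonglongrightarrow> x \<Longrightarrow> isadj x x"
    and isadj_norm: "isadj a b \<Longrightarrow> (norm a)\<^sup>2 \<le> norm (b * a)"
    and isadj_J: "isadj J (- J)"
    and J_square: "J * J = - 1"
    and J_commute: "isadj a b \<Longrightarrow> J * a = a * J"
begin

lemma isadj_uminus: "isadj a a' \<Longrightarrow> isadj (- a) (- a')"
  using isadj_scaleR[of a a' "-1"] by simp

lemma isadj_diff: "isadj a a' \<Longrightarrow> isadj b b' \<Longrightarrow> isadj (a - b) (a' - b')"
  using isadj_add[of a a' "- b" "- b'"] isadj_uminus by simp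

lemma isadj_zero: "isadj 0 0"
  using isadj_scaleR[OF isadj_one, of 0] by simp

lemma isadj_power: "isadj a a' \<Longrightarrow> isadj (a ^ n) (a' ^ n)"
proof (induction n)
  case 0
  then show ?case by (simp add: isadj_one)
next
  case (Suc n)
  then show ?case using isadj_mult[of "a" "a'" "a ^ n" "a' ^ n"] by (simp add: power_commutes)
qed

lemma isadj_sum: "(\<And>k. k \<in> A \<Longrightarrow> isadj (f k) (g k)) \<Longrightarrow> isadj (sum f A) (sum g A)"
  by (induction A rule: infinite_finite_induct) (auto simp: isadj_zero isadj_add)

text \<open>Only an inequality, since \<open>1 = 0\<close> is possible; \<open>isadj_norm\<close> at
  \<open>1\<close> bounds the square of \<open>norm 1\<close> by \<open>norm 1\<close>.\<close>

lemma norm_one_le: "norm (1::'b) \<le> 1"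
proof -
  have "norm (1::'b) * norm (1::'b) \<le> 1 * norm (1::'b)"
    using isadj_norm[OF isadj_one] by (simp add: power2_eq_square)
  then show ?thesis
    by (cases "norm (1::'b) = 0") (simp_all add: mult_le_cancel_right)
qed

lemma isadj_norm_le: "isadj a b \<Longrightarrow> norm a \<le> norm b"
proof -
  assume "isadj a b"
  then have "norm a * norm a \<le> norm b * norm a"
    using isadj_norm norm_mult_ineq[of b a] by (fastforce simp: power2_eq_square)
  then show ?thesis
    by (cases "a = 0") (simp_all add: mult_le_cancel_right)
qed

lemma norm_power_le_one: "norm (a::'b) \<le> 1 \<Longrightarrow> norm (a ^ n) \<le> 1"
proof (induction n)
  case 0
  then show ?case by (simp add: norm_one_le)
next
  case (Suc n)
  have "norm (a * a ^ n) \<le> norm a * norm (a ^ n)" by (rule norm_mult_ineq)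
  also have "\<dots> \<le> 1 * 1" using Suc by (intro mult_mono) auto
  finally show ?case by simp
qed

lemma commute_power: "(a::'b) * b = b * a \<Longrightarrow> a * b ^ n = b ^ n * a"
  by (induction n) (simp, metis mult.assoc power_Suc)

text \<open>The fixed points of \<open>y \<mapsto> (x + y\<^sup>2) / 2\<close> satisfy \<open>(1 - y)\<^sup>2 = 1 - x\<close>; the same recursion at the
  scalar \<open>x = 1\<close> majorises the increments, so no power series is needed.\<close>
lemma sqrt_one_minus:
  fixes x :: 'b
  assumes sa: "isadj x x" and x: "norm x \<le> 1"
  shows "\<exists>r. isadj r r \<and> r * r = 1 - x \<and> norm (1 - r) \<le> 1 \<and> (\<forall>z. z * x = x * z \<longrightarrow> z * r = r * z)"
proof -
  define y where "y = rec_nat (0::'b) (\<lambda>_ u. (1/2) *\<^sub>R (x + u * u))"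
  define \<eta> where "\<eta> = rec_nat (0::real) (\<lambda>_ u. (1 + u * u) / 2)"
  have y0: "y 0 = 0" and yS: "y (Suc n) = (1/2) *\<^sub>R (x + y n * y n)" for n
    by (simp_all add: y_def)
  have \<eta>0: "\<eta> 0 = 0" and \<eta>S: "\<eta> (Suc n) = (1 + \<eta> n * \<eta> n) / 2" for n
    by (simp_all add: \<eta>_def)
  have \<eta>_nonneg: "0 \<le> \<eta> n" for n
    by (cases n) (auto simp: \<eta>0 \<eta>S)
  have \<eta>_le: "\<eta> n \<le> 1" for n
  proof (induction n)
    case (Suc n)
    then show ?case using mult_mono[of "\<eta> n" 1 "\<eta> n" 1] \<eta>_nonneg[of n] by (simp add: \<eta>S)
  qed (simp add: \<eta>0)
  have \<eta>_mono: "\<eta> n \<le> \<eta> (Suc n)" for n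
  proof -
    have "0 \<le> (1 - \<eta> n)\<^sup>2" by simp
    then show ?thesis by (simp add: \<eta>S power2_eq_square algebra_simps)
  qed
  have y_le: "norm (y n) \<le> \<eta> n" for n
  proof (induction n)
    case (Suc n)
    have "norm (y n * y n) \<le> \<eta> n * \<eta> n"
      by (rule order_trans[OF norm_mult_ineq]) (use Suc \<eta>_nonneg in \<open>auto intro!: mult_mono\<close>)
    then show ?case
      using norm_triangle_ineq[of x "y n * y n"] x by (simp add: yS \<eta>S)
  qed (simp add: y0 \<eta>0)
  have y_comm: "z * y n = y n * z" if "z * x = x * z" for z n
  proof (induction n)
    case (Suc n)
    have "z * (y n * y n) = y n * y n * z" by (metis Suc mult.assoc)
    then show ?case using that by (simp add: yS algebra_simps)
  qed (simp add: y0)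
  have yy: "y m * y n = y n * y m" for m n
    by (rule y_comm) (metis y_comm)
  have y_diff: "norm (y (Suc n) - y n) \<le> \<eta> (Suc n) - \<eta> n" for n
  proof (induction n)
    case 0
    then show ?case using x by (simp add: yS y0 \<eta>S \<eta>0)
  next
    case (Suc n)
    \<comment> \<open>The iterates commute, so the difference of squares factors; the scalar
      increments factor in the same way.\<close>
    have "y (Suc (Suc n)) - y (Suc n) = (1/2) *\<^sub>R ((y (Suc n) - y n) * (y (Suc n) + y n))"
      by (subst yS, subst (3) yS) (simp add: algebra_simps yy[of "Suc n" n])
    then have "norm (y (Suc (Suc n)) - y (Suc n)) \<le> (1/2) * (norm (y (Suc n) - y n) * norm (y (Suc n) + y n))"
      using norm_mult_ineq[of "y (Suc n) - y n" "y (Suc n) + y n"] by simp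
    also have "\<dots> \<le> (1/2) * ((\<eta> (Suc n) - \<eta> n) * (\<eta> (Suc n) + \<eta> n))"
      using Suc y_le[of "Suc n"] y_le[of n] norm_triangle_ineq[of "y (Suc n)" "y n"] \<eta>_mono[of n]
      by (intro mult_left_mono mult_mono) auto
    also have "\<dots> = \<eta> (Suc (Suc n)) - \<eta> (Suc n)"
      by (subst \<eta>S, subst (3) \<eta>S) (simp add: field_simps)
    finally show ?case .
  qed
  \<comment> \<open>The scalar sequence is increasing and bounded by 1, so its increments are
    summable, and they dominate those of \<open>y\<close>.\<close>
  have "summable (\<lambda>n. \<eta> (Suc n) - \<eta> n)"
    by (rule telescope_summable[of \<eta> "lim \<eta>"])
       (metis convergent_LIMSEQ_iff incseq_SucI incseq_convergent \<eta>_mono \<eta>_le convergentI)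
  then have "summable (\<lambda>n. y (Suc n) - y n)"
    by (rule summable_comparison_test'[where N = 0]) (use y_diff in simp)
  then obtain L where "(\<lambda>n. \<Sum>k<n. y (Suc k) - y k) \<longlonglongrightarrow> L"
    by (auto simp: summable_def sums_def)
  then have lim: "y \<longlonglongrightarrow> L"
    by (simp add: sum_lessThan_telescope y0)
  have "(\<lambda>n. y (Suc n)) \<longlonglongrightarrow> (1/2) *\<^sub>R (x + L * L)"
    unfolding yS by (intro tendsto_intros lim)
  with lim have "(1/2) *\<^sub>R (x + L * L) = L"
    using LIMSEQ_Suc LIMSEQ_unique by blast
  then have "2 *\<^sub>R L = 2 *\<^sub>R (1/2) *\<^sub>R (x + L * L)"
    by simp
  then have "x + L * L = 2 *\<^sub>R L"
    by simp
  then have sq: "(1 - L) * (1 - L) = 1 - x"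
    by (simp add: algebra_simps scaleR_2)
  have "isadj (y n) (y n)" for n
    by (induction n) (auto simp: y0 yS isadj_zero sa intro!: isadj_scaleR isadj_add isadj_mult)
  then have saL: "isadj (1 - L) (1 - L)"
    by (intro isadj_diff isadj_one isadj_limit[OF _ lim])
  have "norm L \<le> 1"
    by (rule LIMSEQ_le_const2[OF tendsto_norm[OF lim]]) (meson y_le \<eta>_le order_trans)
  have "z * L = L * z" if "z * x = x * z" for z
  proof (rule LIMSEQ_unique)
    show "(\<lambda>n. z * y n) \<longlonglongrightarrow> z * L"
      by (intro tendsto_intros lim)
    show "(\<lambda>n. z * y n) \<longlonglongrightarrow> L * z"
      unfolding y_comm[OF that] by (rule tendsto_mult[OF lim tendsto_const])
  qed
  then have "\<forall>z. z * x = x * z \<longrightarrow> z * (1 - L) = (1 - L) * z"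
    by (metis left_diff_distrib mult_1 mult_1_right right_diff_distrib)
  moreover have "norm (1 - (1 - L)) \<le> 1"
    using \<open>norm L \<le> 1\<close> by simp
  ultimately show ?thesis
    using sq saL by blast
qed

text \<open>\<open>r + J s\<close> is a multiple of a unitary and \<open>r\<close> is its real part.\<close>
lemma norm_le_of_circle:
  assumes r: "isadj r r" and s: "isadj s s" and comm: "r * s = s * r"
    and eq: "r * r + s * s = t *\<^sub>R 1" and t: "0 \<le> t"
  shows "norm r \<le> sqrt t"
proof -
  have Js: "isadj (J * s) (- (J * s))"
    using isadj_mult[OF isadj_J s] J_commute[OF s] by simp
  have J2: "(J * s) * (J * s) = - (s * s)"
  proof -
    have "(J * s) * (J * s) = J * (s * J) * s" by (simp add: mult.assoc)
    also have "\<dots> = (J * J) * (s * s)" by (simp add: J_commute[OF s, symmetric] mult.assoc)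
    finally show ?thesis by (simp add: J_square)
  qed
  have rJ: "r * (J * s) = (J * s) * r"
    by (metis J_commute[OF r] comm mult.assoc)
  have u: "isadj (r + J * s) (r - J * s)"
    using isadj_add[OF r Js] by simp
  have "(r - J * s) * (r + J * s) = t *\<^sub>R 1"
    using J2 rJ eq by (simp add: algebra_simps)
  then have "(norm (r + J * s))\<^sup>2 \<le> norm (t *\<^sub>R (1::'b))"
    using isadj_norm[OF u] by simp
  also have "\<dots> \<le> t" using norm_one_le t by (simp add: mult_left_le)
  finally have u_le: "norm (r + J * s) \<le> sqrt t"
    by (simp add: real_le_rsqrt)
  have "norm (2 *\<^sub>R r) \<le> norm (r + J * s) + norm (r - J * s)"
    using norm_triangle_ineq[of "r + J * s" "r - J * s"] by (simp add: scaleR_2)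
  also have "\<dots> \<le> sqrt t + sqrt t"
    using u_le isadj_norm_le[OF isadj_sym[OF u]] by linarith
  finally show ?thesis by simp
qed

text \<open>Spectrally this puts the spectrum of \<open>h\<close> inside \<open>[0, 2 t]\<close>.
  Leaving \<open>t\<close> free makes closure under sums and nonnegative multiples
  immediate.\<close>

definition pos :: "'b \<Rightarrow> bool" where
  "pos h \<longleftrightarrow> isadj h h \<and> (\<exists>t\<ge>0. norm (t *\<^sub>R 1 - h) \<le> t)"

lemma pos_sa: "pos h \<Longrightarrow> isadj h h"
  by (simp add: pos_def)

lemma pos_add: assumes "pos h" "pos k" shows "pos (h + k)"
proof -
  obtain s t where "s \<ge> 0" "t \<ge> 0" "norm (s *\<^sub>R 1 - h) \<le> s" "norm (t *\<^sub>R 1 - k) \<le> t"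
    using assms by (auto simp: pos_def)
  moreover have "(s + t) *\<^sub>R 1 - (h + k) = (s *\<^sub>R 1 - h) + (t *\<^sub>R 1 - k)"
    by (simp add: algebra_simps)
  ultimately have "norm ((s + t) *\<^sub>R 1 - (h + k)) \<le> s + t"
    by (metis add_mono norm_triangle_ineq order_trans)
  then show ?thesis
    using assms \<open>s \<ge> 0\<close> \<open>t \<ge> 0\<close> isadj_add unfolding pos_def by (metis add_nonneg_nonneg)
qed

lemma pos_scaleR: assumes "pos h" "0 \<le> c" shows "pos (c *\<^sub>R h)"
proof -
  obtain t where t: "t \<ge> 0" "norm (t *\<^sub>R 1 - h) \<le> t" and h: "isadj h h"
    using assms by (auto simp: pos_def)
  have "(c * t) *\<^sub>R 1 - c *\<^sub>R h = c *\<^sub>R (t *\<^sub>R 1 - h)"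
    by (simp add: algebra_simps)
  then have "norm ((c * t) *\<^sub>R 1 - c *\<^sub>R h) \<le> c * t"
    using t assms(2) by (simp add: mult_left_mono)
  then show ?thesis
    using assms(2) t(1) isadj_scaleR[OF h] unfolding pos_def by (metis mult_nonneg_nonneg)
qed

lemma pos_scaleR_iff: "0 < c \<Longrightarrow> pos (c *\<^sub>R h) \<longleftrightarrow> pos h"
  using pos_scaleR[of "c *\<^sub>R h" "inverse c"] pos_scaleR[of h c] by auto

lemma pos_one_minus: "isadj h h \<Longrightarrow> norm h \<le> t \<Longrightarrow> pos (t *\<^sub>R 1 - h)"
  unfolding pos_def
  by (intro conjI exI[of _ t] isadj_diff isadj_scaleR isadj_one) (auto intro: order_trans[OF norm_ge_zero])

lemma pos_zero: "pos 0"
  unfolding pos_def by (auto simp: isadj_zero intro!: exI[of _ 0])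

lemma pos_one: "pos 1"
  unfolding pos_def by (auto simp: isadj_one intro!: exI[of _ 1])

text \<open>The element \<open>x = 1 - h/t\<close> has norm at most 1, so \<open>h/t = 1 - x\<close>
  has a root, which is rescaled by \<open>sqrt t\<close>. The commutation clause later makes roots
  of commuting elements commute.\<close>

lemma pos_sqrt:
  assumes "pos h"
  shows "\<exists>r. pos r \<and> r * r = h \<and> (\<forall>z. z * h = h * z \<longrightarrow> z * r = r * z)"
proof -
  obtain t where t: "t \<ge> 0" "norm (t *\<^sub>R 1 - h) \<le> t" and h: "isadj h h"
    using assms by (auto simp: pos_def)
  show ?thesis
  proof (cases "t = 0")
    case True
    then show ?thesis using t by (auto intro!: exI[of _ 0] pos_zero)
  next
    case False
    then have t0: "t > 0" using t by simp
    define x where "x = 1 - (1/t) *\<^sub>R h"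
    have "x = (1/t) *\<^sub>R (t *\<^sub>R 1 - h)"
      using t0 by (simp add: x_def algebra_simps)
    then have "norm x \<le> 1" using t t0 by simp
    moreover have "isadj x x"
      unfolding x_def by (intro isadj_diff isadj_one isadj_scaleR h)
    ultimately obtain r where r: "isadj r r" "r * r = 1 - x" "norm (1 - r) \<le> 1"
      "\<And>z. z * x = x * z \<Longrightarrow> z * r = r * z"
      using sqrt_one_minus by blast
    have "pos r" unfolding pos_def using r(1,3) by (auto intro!: exI[of _ 1])
    then have "pos (sqrt t *\<^sub>R r)" using t0 by (simp add: pos_scaleR)
    moreover have "(sqrt t *\<^sub>R r) * (sqrt t *\<^sub>R r) = h"
      using t0 r(2) by (simp add: x_def)
    moreover have "z * (sqrt t *\<^sub>R r) = (sqrt t *\<^sub>R r) * z" if "z * h = h * z" for z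
      using r(4)[of z] that by (simp add: x_def algebra_simps)
    ultimately show ?thesis by blast
  qed
qed

text \<open>A root \<open>r\<close> of \<open>1 - k * k\<close> commutes with \<open>k\<close>, so
  \<open>r\<close> and \<open>k\<close> lie on the unit circle and \<open>norm r \<le> 1\<close>;
  now square.\<close>

lemma norm_one_minus_square:
  assumes k: "isadj k k" and "norm k \<le> 1"
  shows "norm (1 - k * k) \<le> 1"
proof -
  have "norm (k * k) \<le> 1 * 1"
    by (rule order_trans[OF norm_mult_ineq], rule mult_mono) (use assms in auto)
  then have "norm (k * k) \<le> 1" by simp
  then obtain r where r: "isadj r r" "r * r = 1 - k * k"
      "\<And>z. z * (k * k) = (k * k) * z \<Longrightarrow> z * r = r * z"
    using sqrt_one_minus[OF isadj_mult[OF k k]] by blast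
  have "norm r \<le> sqrt 1"
    by (rule norm_le_of_circle[OF r(1) k])
       (simp_all add: r(2) r(3)[of k, symmetric] mult.assoc)
  then have "norm r * norm r \<le> 1 * 1"
    by (intro mult_mono) auto
  then show ?thesis
    using norm_mult_ineq[of r r] r(2) by simp
qed

lemma pos_square: assumes "isadj k k" shows "pos (k * k)"
proof (cases "k = 0")
  case True
  then show ?thesis by (simp add: pos_zero)
next
  case False
  define j where "j = (1 / norm k) *\<^sub>R k"
  have j: "isadj j j" "norm j \<le> 1"
    using assms False by (auto simp: j_def isadj_scaleR)
  then have "pos (j * j)"
    unfolding pos_def using norm_one_minus_square[OF j]
    by (auto intro!: exI[of _ 1] isadj_mult)
  moreover have "k * k = (norm k)\<^sup>2 *\<^sub>R (j * j)"
    using False by (simp add: j_def power2_eq_square)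
  ultimately show ?thesis by (simp add: pos_scaleR)
qed

text \<open>The roots \<open>r\<close> of \<open>h\<close> and \<open>s\<close> of \<open>k\<close>
  commute, so \<open>r * s\<close> is self-adjoint, and \<open>h * k\<close> is its square.\<close>

lemma pos_mult: assumes "pos h" "pos k" "h * k = k * h" shows "pos (h * k)"
proof -
  obtain r where r: "pos r" "r * r = h" "\<And>z. z * h = h * z \<Longrightarrow> z * r = r * z"
    using pos_sqrt[OF assms(1)] by blast
  obtain s where s: "pos s" "s * s = k" "\<And>z. z * k = k * z \<Longrightarrow> z * s = s * z"
    using pos_sqrt[OF assms(2)] by blast
  have "r * k = k * r" using r(3)[of k] assms(3) by simp
  then have rs: "r * s = s * r" using s(3) by blast
  have "isadj (r * s) (r * s)"
    using isadj_mult[OF pos_sa[OF r(1)] pos_sa[OF s(1)]] rs by simp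
  then have "pos ((r * s) * (r * s))" by (rule pos_square)
  also have "(r * s) * (r * s) = r * (s * r) * s" by (simp add: mult.assoc)
  also have "\<dots> = h * k" by (simp add: rs[symmetric] r(2)[symmetric] s(2)[symmetric] mult.assoc)
  finally show ?thesis .
qed

lemma pos_power: "pos h \<Longrightarrow> pos (h ^ n)"
  by (induction n) (simp_all add: pos_one power_commutes pos_mult)

text \<open>Commuting roots of \<open>h\<close> and of \<open>t - h\<close> have squares summing to
  \<open>t\<close>, so the circle estimate bounds the root of \<open>h\<close> by
  \<open>sqrt t\<close>.\<close>

lemma pos_norm_le:
  assumes "pos h" "pos (t *\<^sub>R 1 - h)" "0 \<le> t" shows "norm h \<le> t"
proof -
  obtain r where r: "pos r" "r * r = h" "\<And>z. z * h = h * z \<Longrightarrow> z * r = r * z"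
    using pos_sqrt[OF assms(1)] by blast
  obtain s where s: "pos s" "s * s = t *\<^sub>R 1 - h"
      "\<And>z. z * (t *\<^sub>R 1 - h) = (t *\<^sub>R 1 - h) * z \<Longrightarrow> z * s = s * z"
    using pos_sqrt[OF assms(2)] by blast
  have "r * h = h * r" using r(2) by (metis mult.assoc)
  then have "r * s = s * r" by (intro s(3)) (simp add: algebra_simps)
  then have "norm r \<le> sqrt t"
    by (rule norm_le_of_circle[OF pos_sa[OF r(1)] pos_sa[OF s(1)] _ _ assms(3)])
       (simp add: r(2) s(2))
  then have "norm r * norm r \<le> sqrt t * sqrt t"
    using assms(3) by (intro mult_mono) auto
  then show ?thesis
    using norm_mult_ineq[of r r] r(2) assms(3) by simp
qed

lemma pos_antisym: "pos h \<Longrightarrow> pos (- h) \<Longrightarrow> h = 0"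
  using pos_norm_le[of h 0] by simp

lemma pos_norm_mono: assumes "pos a" "pos (b - a)" shows "norm a \<le> norm b"
proof -
  have "isadj b b" using isadj_add[OF pos_sa pos_sa, OF assms(2,1)] by simp
  then have "pos (norm b *\<^sub>R 1 - b)" by (rule pos_one_minus) simp
  from pos_add[OF this assms(2)] show ?thesis
    by (intro pos_norm_le assms) (simp_all add: algebra_simps)
qed

text \<open>The witness \<open>norm h\<close> does not depend on \<open>e\<close>: the root of
  \<open>h + e\<close>, divided by the square root of \<open>norm h + e\<close>, is a contraction
  \<open>j\<close>, and \<open>norm (1 - j * j) \<le> 1\<close> says that
  \<open>norm (norm h - h) \<le> norm h + e\<close>.\<close>

lemma pos_limit:
  assumes h: "isadj h h" and eps: "\<And>e. e > 0 \<Longrightarrow> pos (h + e *\<^sub>R 1)"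
  shows "pos h"
proof -
  have "norm (norm h *\<^sub>R 1 - h) \<le> norm h + e" if e: "e > 0" for e
  proof -
    obtain r where r: "pos r" "r * r = h + e *\<^sub>R 1"
      using pos_sqrt[OF eps[OF e]] by blast
    have "(norm r)\<^sup>2 \<le> norm (h + e *\<^sub>R 1)"
      using isadj_norm[OF pos_sa[OF r(1)]] r(2) by simp
    also have "\<dots> \<le> norm h + norm (e *\<^sub>R (1::'b))" by (rule norm_triangle_ineq)
    also have "norm (e *\<^sub>R (1::'b)) \<le> e" using e norm_one_le by (simp add: mult_left_le)
    finally have nr: "(norm r)\<^sup>2 \<le> norm h + e" by simp
    define t where "t = norm h + e"
    have t: "t > 0" using e by (simp add: t_def add_nonneg_pos)
    define j where "j = (1 / sqrt t) *\<^sub>R r"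
    have "norm r \<le> sqrt t" using nr t by (simp add: t_def real_le_rsqrt)
    then have "norm j \<le> 1" "isadj j j"
      using t pos_sa[OF r(1)] by (auto simp: j_def isadj_scaleR)
    then have "norm (1 - j * j) \<le> 1" by (simp add: norm_one_minus_square)
    moreover have "t *\<^sub>R (1 - j * j) = norm h *\<^sub>R 1 - h"
    proof -
      have "t *\<^sub>R (j * j) = h + e *\<^sub>R 1"
        using t r(2) by (simp add: j_def)
      then show ?thesis by (simp add: t_def algebra_simps)
    qed
    ultimately have "norm (norm h *\<^sub>R 1 - h) \<le> t * 1"
      using t by (metis abs_of_pos mult_left_mono norm_scaleR order_less_imp_le)
    then show ?thesis by (simp add: t_def)
  qed
  then have "norm (norm h *\<^sub>R 1 - h) \<le> norm h"
    by (rule field_le_epsilon)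
  then show ?thesis using h by (auto simp: pos_def intro!: exI[of _ "norm h"])
qed

end

section \<open>Positivity of \<open>a' * a\<close>, uniqueness of roots and a decay estimate\<close>

context star_relation
begin

text \<open>The product is \<open>(1 - y)^2\<close> times \<open>1 + y + ... + y^(k-1)\<close>; the
  induction adds one power of \<open>y\<close> at a time.\<close>

lemma pos_one_minus_mult_power:
  assumes "pos y" shows "pos ((1 - y) * (1 - y ^ k))"
proof (induction k)
  case 0
  then show ?case by (simp add: pos_zero)
next
  case (Suc k)
  have "pos ((1 - y) * (1 - y))"
    by (intro pos_square isadj_diff isadj_one pos_sa assms)
  then have "pos ((1 - y) * (1 - y) * y ^ k)"
    by (rule pos_mult[OF _ pos_power[OF assms] commute_power]) (simp add: algebra_simps)
  moreover have "(1 - y) * (1 - y ^ Suc k) = (1 - y) * (1 - y ^ k) + (1 - y) * (1 - y) * y ^ k"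
    by (simp add: algebra_simps)
  ultimately show ?case using Suc by (simp add: pos_add)
qed

text \<open>The induction needs the sharper bound with \<open>1 - y^(m+1)\<close> in place of
  \<open>1\<close>. The difference is then the sum of \<open>(1 - y) * (y^k - y^m)\<close> over
  \<open>k \<le> m\<close>, where each term is nonnegative for a scalar
  \<open>y \<ge> 0\<close>.\<close>

lemma pos_power_bound:
  assumes "pos y" shows "pos (1 - real (Suc m) *\<^sub>R ((1 - y) * y ^ m))"
proof -
  have "pos (1 - y ^ Suc m - real (Suc m) *\<^sub>R ((1 - y) * y ^ m))"
  proof (induction m)
    case 0
    then show ?case by (simp add: pos_zero)
  next
    case (Suc m)
    let ?E = "1 - y ^ Suc m - real (Suc m) *\<^sub>R ((1 - y) * y ^ m)"
    have "pos (y * ?E)"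
      using assms Suc by (rule pos_mult) (simp add: algebra_simps power_commutes)
    moreover have "1 - y ^ Suc (Suc m) - real (Suc (Suc m)) *\<^sub>R ((1 - y) * y ^ Suc m)
        = y * ?E + (1 - y) * (1 - y ^ Suc m)"
      by (simp add: algebra_simps scaleR_2)
    ultimately show ?case
      using pos_one_minus_mult_power[OF assms] by (metis pos_add)
  qed
  from pos_add[OF this pos_power[OF assms, of "Suc m"]] show ?thesis
    by simp
qed

text \<open>Twice this element is the sum of the squares of the self-adjoint elements
  \<open>c + c'\<close> and \<open>J * (c - c')\<close>, that is, of the doubled real and imaginary
  parts up to sign.\<close>

lemma pos_mult_adj_add:
  assumes "isadj c c'" shows "pos (c' * c + c * c')"
proof -
  have sa1: "isadj (c + c') (c + c')"
    using isadj_add[OF assms isadj_sym[OF assms]] by (simp add: add.commute)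
  have d: "isadj (c - c') (c' - c)"
    by (intro isadj_diff assms isadj_sym[OF assms])
  have "isadj (J * (c - c')) (J * (c - c'))"
    using isadj_mult[OF isadj_J d] by (simp add: J_commute[OF d] left_diff_distrib)
  then have "pos ((c + c') * (c + c') + (J * (c - c')) * (J * (c - c')))"
    by (intro pos_add pos_square sa1)
  also have "(J * (c - c')) * (J * (c - c')) = J * ((c - c') * J) * (c - c')"
    by (simp add: mult.assoc)
  also have "\<dots> = (J * J) * ((c - c') * (c - c'))"
    by (simp only: J_commute[OF d, symmetric] mult.assoc)
  also have "(c + c') * (c + c') + \<dots> = 2 *\<^sub>R (c' * c + c * c')"
    by (simp add: J_square algebra_simps scaleR_2)
  finally show ?thesis by (simp add: pos_scaleR_iff)
qed

text \<open>For \<open>\<parallel>a\<parallel> \<le> 1\<close> put \<open>c = a (1 - a' a)\<^sup>n\<close>. Then \<open>c' c + c c' \<ge> 0\<close>, \<open>c c' \<le> 1 / (2 n + 1)\<close> and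
  \<open>c' c \<le> a' a\<close>, whence \<open>a' a \<ge> - 1 / (2 n + 1)\<close>.\<close>
theorem pos_adj_mult:
  assumes "isadj a a'" shows "pos (a' * a)"
proof -
  have contraction: "pos (a' * a)" if a: "isadj a a'" and na: "norm a \<le> 1" for a a'
  proof -
    have na': "norm a' \<le> 1"
      using isadj_norm_le[OF isadj_sym[OF a]] na by simp
    define B where "B = a' * a"
    define D where "D = a * a'"
    have saB: "isadj B B" and saD: "isadj D D"
      unfolding B_def D_def by (intro isadj_mult a isadj_sym[OF a])+
    have "norm a' * norm a \<le> 1"
      using na na' by (intro mult_le_one) auto
    then have "norm B \<le> 1" "norm D \<le> 1"
      using norm_mult_ineq[of a' a] norm_mult_ineq[of a a'] by (auto simp: B_def D_def mult.commute)
    then have z: "pos (1 - B)" and y: "pos (1 - D)"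
      using pos_one_minus[OF saB, of 1] pos_one_minus[OF saD, of 1] by simp_all
    have bound: "pos (B + (1 / real (Suc (2 * n))) *\<^sub>R 1)" for n
    proof -
      let ?Z = "(1 - B) ^ n" and ?m = "2 * n"
      have az: "a * (1 - B) = (1 - D) * a"
        by (simp add: B_def D_def algebra_simps)
      \<comment> \<open>Moving \<open>a\<close> past the powers turns \<open>c c'\<close> into an
        expression in \<open>D\<close> alone, to which the power bound applies.\<close>
      have azk: "a * (1 - B) ^ k = (1 - D) ^ k * a" for k
      proof (induction k)
        case (Suc k)
        have "a * (1 - B) ^ Suc k = a * (1 - B) * (1 - B) ^ k" by (simp add: mult.assoc)
        also have "\<dots> = (1 - D) * (a * (1 - B) ^ k)" by (simp add: az mult.assoc)
        finally show ?case by (simp add: Suc mult.assoc)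
      qed simp
      have c: "isadj (a * ?Z) (?Z * a')"
        by (intro isadj_mult a isadj_power pos_sa[OF z])
      have BZ: "B * ?Z = ?Z * B"
        by (intro commute_power) (simp add: algebra_simps)
      have "(?Z * a') * (a * ?Z) = ?Z * (B * ?Z)" by (simp add: B_def mult.assoc)
      also have "\<dots> = B * (?Z * ?Z)" unfolding BZ by (metis BZ mult.assoc)
      also have "?Z * ?Z = (1 - B) ^ ?m" by (simp add: mult_2 power_add)
      finally have 1: "(?Z * a') * (a * ?Z) = B * (1 - B) ^ ?m" .
      have "(a * ?Z) * (?Z * a') = a * (?Z * ?Z) * a'" by (simp add: mult.assoc)
      also have "?Z * ?Z = (1 - B) ^ ?m" by (simp add: mult_2 power_add)
      also have "a * (1 - B) ^ ?m * a' = (1 - D) ^ ?m * D" by (simp add: azk D_def mult.assoc)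
      also have "\<dots> = D * (1 - D) ^ ?m" by (intro commute_power[symmetric]) (simp add: algebra_simps)
      finally have 2: "(a * ?Z) * (?Z * a') = D * (1 - D) ^ ?m" .
      have p1: "pos (B * (1 - B) ^ ?m + D * (1 - D) ^ ?m)"
        using pos_mult_adj_add[OF c] unfolding 1 2 .
      have p2: "pos (B - B * (1 - B) ^ ?m)"
        using pos_one_minus_mult_power[OF z, of ?m] by (simp add: algebra_simps)
      have "pos (1 - real (Suc ?m) *\<^sub>R (D * (1 - D) ^ ?m))"
        using pos_power_bound[OF y, of ?m] by simp
      then have p3: "pos ((1 / real (Suc ?m)) *\<^sub>R (1 - real (Suc ?m) *\<^sub>R (D * (1 - D) ^ ?m)))"
        by (rule pos_scaleR) simp
      have "(1 / real (Suc ?m)) *\<^sub>R (1 - real (Suc ?m) *\<^sub>R (D * (1 - D) ^ ?m))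
          = (1 / real (Suc ?m)) *\<^sub>R 1 - D * (1 - D) ^ ?m"
        by (simp add: scaleR_diff_right del: of_nat_Suc)
      with pos_add[OF pos_add[OF p1 p2] p3] show ?thesis by (simp add: algebra_simps)
    qed
    have "pos B"
    proof (rule pos_limit[OF saB])
      fix e :: real assume "e > 0"
      then obtain n where "inverse (real (Suc n)) < e"
        using reals_Archimedean by blast
      moreover have "1 / real (Suc (2 * n)) \<le> inverse (real (Suc n))"
        by (simp add: divide_simps)
      ultimately have "pos ((e - 1 / real (Suc (2 * n))) *\<^sub>R 1)"
        by (intro pos_scaleR pos_one) simp
      from pos_add[OF bound[of n] this] show "pos (B + e *\<^sub>R 1)"
        by (simp add: algebra_simps)
    qed
    then show ?thesis by (simp add: B_def)
  qed
  show ?thesis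
  proof (cases "a = 0")
    case True
    then show ?thesis by (simp add: pos_zero)
  next
    case False
    have "pos (((1 / norm a) *\<^sub>R a') * ((1 / norm a) *\<^sub>R a))"
      using False by (intro contraction isadj_scaleR assms) simp
    moreover have "((1 / norm a) *\<^sub>R a') * ((1 / norm a) *\<^sub>R a) = (1 / norm a)\<^sup>2 *\<^sub>R (a' * a)"
      by (simp add: power2_eq_square)
    ultimately show ?thesis
      using False by (simp add: pos_scaleR_iff)
  qed
qed

text \<open>With \<open>h = r * r\<close> this is the product of \<open>r * b\<close> with its
  adjoint.\<close>

lemma pos_conj:
  assumes "pos h" "isadj b b'" shows "pos (b' * h * b)"
proof -
  obtain r where r: "pos r" "r * r = h"
    using pos_sqrt[OF assms(1)] by blast
  have "pos ((b' * r) * (r * b))"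
    by (intro pos_adj_mult isadj_mult assms pos_sa[OF r(1)])
  then show ?thesis by (simp add: r(2)[symmetric] mult.assoc)
qed

text \<open>Every positive root \<open>v\<close> is compared with the root \<open>r\<close> that
  commutes with the commutant of \<open>s * s\<close>. For \<open>d = r - v\<close> one has
  \<open>(r + v) * d = 0\<close>, so the positive elements \<open>d * r * d\<close> and
  \<open>d * v * d\<close> add up to 0 and both vanish.\<close>

lemma pos_sqrt_unique:
  assumes s: "pos s" and s': "pos s'" and eq: "s * s = s' * s'"
  shows "s = s'"
proof -
  have "pos (s * s)"
    by (intro pos_square pos_sa s)
  then obtain r where r: "pos r" "r * r = s * s" "\<And>z. z * (s * s) = (s * s) * z \<Longrightarrow> z * r = r * z"
    using pos_sqrt by blast
  have "v = r" if v: "pos v" and vv: "v * v = s * s" for v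
  proof -
    have vr: "v * r = r * v"
      by (rule r(3)) (metis vv mult.assoc)
    define d where "d = r - v"
    have d: "isadj d d"
      unfolding d_def by (intro isadj_diff pos_sa v r(1))
    have pr: "pos (d * r * d)" and pv: "pos (d * v * d)"
      by (intro pos_conj v r(1) d)+
    have "(r + v) * d = 0"
      by (simp add: d_def algebra_simps vr vv r(2))
    then have "d * ((r + v) * d) = 0" by simp
    then have "d * r * d + d * v * d = 0" by (simp add: algebra_simps)
    then have "d * v * d = - (d * r * d)" by (simp add: eq_neg_iff_add_eq_0 add.commute)
    with pos_antisym[OF pr] pv have "d * r * d = 0" "d * v * d = 0" by auto
    then have "d * (r - v) * d = 0" by (simp add: algebra_simps)
    \<comment> \<open>The cube of \<open>d\<close> vanishes, hence also its fourth power; applying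
      the C*-inequality twice then gives \<open>d = 0\<close>.\<close>
    then have "(d * d) * (d * d) = 0" by (simp add: d_def[symmetric] mult.assoc)
    then have "d * d = 0"
      using isadj_norm[OF isadj_mult[OF d d]] by simp
    then have "d = 0"
      using isadj_norm[OF d] by simp
    then show ?thesis by (simp add: d_def)
  qed
  from this[OF s] this[OF s'] eq show ?thesis by simp
qed

text \<open>This is \<open>pos_power_bound\<close> at \<open>y = 1 - g\<close>. It provides the rate
  of convergence of the approximate inverses of the modulus.\<close>

lemma norm_mult_power_one_minus_le:
  assumes "pos g" "norm g \<le> 1"
  shows "norm (g * (1 - g) ^ n) \<le> 1 / real (Suc n)"
proof -
  have y: "pos (1 - g)"
    using pos_one_minus[OF pos_sa[OF assms(1)] assms(2)] by simp
  have "pos (g * (1 - g) ^ n)"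
    by (intro pos_mult assms pos_power y commute_power) (simp add: algebra_simps)
  moreover have "pos ((1 / real (Suc n)) *\<^sub>R (1 - real (Suc n) *\<^sub>R (g * (1 - g) ^ n)))"
    using pos_power_bound[OF y, of n] by (intro pos_scaleR) (auto simp del: of_nat_Suc)
  ultimately show ?thesis
    by (intro pos_norm_le) (simp_all add: scaleR_diff_right del: of_nat_Suc)
qed

end

section \<open>Order in a C*-algebra and the Cauchy-Schwarz inequality\<close>

lemma scaleC_minus_one: "(- 1) *\<^sub>C x = - (x::'a::complex_banach)"
  using scaleC_of_real[of "-1" x] by simp

lemma scaleC_scaleR: "c *\<^sub>C (r *\<^sub>R x) = r *\<^sub>R (c *\<^sub>C (x::'a::complex_banach))"
  by (simp add: scaleC_of_real[symmetric] scaleC_scaleC mult.commute)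

lemma bounded_linear_scaleC: "bounded_linear (\<lambda>x::'a::complex_banach. c *\<^sub>C x)"
  by (rule bounded_linear_intro[where K = "cmod c"])
     (simp_all add: scaleC_add_right scaleC_scaleR norm_scaleC mult.commute)

lemma star_zero [simp]: "star (0::'a::cstar_algebra) = 0"
  using star_add[of 0 "0::'a"] by simp

lemma norm_star [simp]: "norm (star a) = norm (a::'a::cstar_algebra)"
proof -
  have le: "norm a \<le> norm (star a)" for a :: 'a
  proof -
    have "norm a * norm a \<le> norm (star a) * norm a"
      using norm_mult_ineq[of "star a" a] by (simp add: cstar_identity power2_eq_square)
    then show ?thesis
      by (cases "a = 0") (simp_all add: mult_le_cancel_right)
  qed
  from le[of a] le[of "star a"] show ?thesis by (simp add: star_star)
qed

locale ip_space =
  fixes ip :: "'h::complex_banach \<Rightarrow> 'h \<Rightarrow> 'a::cstar_algebra"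
  assumes ip_add: "ip x (y + z) = ip x y + ip x z"
    and ip_scaleC: "ip x (c *\<^sub>C y) = c *\<^sub>C ip x y"
    and ip_star: "star (ip x y) = ip y x"
    and ip_norm: "norm x = sqrt (norm (ip x x))"
begin

lemma ip_add_left: "ip (x + y) z = ip x z + ip y z"
  by (metis ip_add ip_star star_add)

lemma ip_scaleC_left: "ip (c *\<^sub>C x) y = cnj c *\<^sub>C ip x y"
  by (metis ip_scaleC ip_star star_scaleC)

lemma ip_zero [simp]: "ip x 0 = 0" "ip 0 x = 0"
proof -
  show "ip x 0 = 0" using ip_add[of x 0 0] by simp
  then show "ip 0 x = 0" by (metis ip_star star_zero)
qed

lemma ip_minus: "ip x (- y) = - ip x y" "ip (- x) y = - ip x y"
  using ip_add[of x y "- y"] ip_add_left[of x "- x" y]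
  by (simp_all add: eq_neg_iff_add_eq_0 add.commute)

lemma ip_diff: "ip x (y - z) = ip x y - ip x z" "ip (x - y) z = ip x z - ip y z"
  using ip_add[of x y "- z"] ip_add_left[of x "- y" z] by (simp_all add: ip_minus)

lemma ip_scaleR: "ip x (r *\<^sub>R y) = r *\<^sub>R ip x y" "ip (r *\<^sub>R x) y = r *\<^sub>R ip x y"
  by (simp_all add: scaleC_of_real[symmetric] ip_scaleC ip_scaleC_left)

lemma norm_ip_self: "norm (ip x x) = (norm x)\<^sup>2"
  by (simp add: ip_norm)

lemma ip_self_eq_0: "ip x x = 0 \<Longrightarrow> x = 0"
  using norm_ip_self[of x] by simp

lemma ip_eqI: "(\<And>y. ip u y = ip v y) \<Longrightarrow> u = v"
  using ip_self_eq_0[of "u - v"] by (simp add: ip_diff(2))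

lemma ip_eqI2: "(\<And>y. ip y u = ip y v) \<Longrightarrow> u = v"
  by (rule ip_eqI) (metis ip_star)

end

text \<open>Cauchy-Schwarz is an assumption here to avoid a circle: for the algebra acting on itself
  it is submultiplicativity of the norm, and the order obtained from that instance proves it for
  every Hilbert module.\<close>

locale ip_module = ip_space ip
  for ip :: "'h::complex_banach \<Rightarrow> 'h \<Rightarrow> 'a::cstar_algebra" +
  assumes ip_bound: "norm (ip x y) \<le> norm x * norm y"
begin

lemma bounded_bilinear_ip: "bounded_bilinear ip"
  by (unfold_locales)
     (auto simp: ip_add ip_add_left ip_scaleR ip_bound intro!: exI[of _ 1])

lemmas tendsto_ip = bounded_bilinear.tendsto[OF bounded_bilinear_ip]

definition endo_adj :: "'h endo \<Rightarrow> 'h endo \<Rightarrow> bool" where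
  "endo_adj f g \<longleftrightarrow> (\<forall>x y. ip (endo_app f x) y = ip x (endo_app g y))"

lemma endo_adjD: "endo_adj f g \<Longrightarrow> ip (endo_app f x) y = ip x (endo_app g y)"
  by (simp add: endo_adj_def)

text \<open>The type \<open>endo\<close> contains all bounded real-linear maps; having an adjoint
  forces complex linearity, hence commutation with \<open>J\<close>. The norm inequality is
  Cauchy-Schwarz applied to \<open>ip x (b a x)\<close>.\<close>

sublocale star_relation endo_adj "endo_of (\<lambda>x. \<i> *\<^sub>C x)"
proof
  fix a a' b b' :: "'h endo" and r :: real
  note J [simp] = endo_app_endo_of[OF bounded_linear_scaleC[of \<i>]]
  show "endo_adj a b \<Longrightarrow> endo_adj b a"
    unfolding endo_adj_def by (metis ip_star)
  show "endo_adj a a' \<Longrightarrow> endo_adj b b' \<Longrightarrow> endo_adj (a + b) (a' + b')"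
    by (simp add: endo_adj_def ip_add ip_add_left)
  show "endo_adj a a' \<Longrightarrow> endo_adj (r *\<^sub>R a) (r *\<^sub>R a')"
    by (simp add: endo_adj_def ip_scaleR)
  show "endo_adj a a' \<Longrightarrow> endo_adj b b' \<Longrightarrow> endo_adj (a * b) (b' * a')"
    by (simp add: endo_adj_def)
  show "endo_adj 1 1"
    by (simp add: endo_adj_def)
  show "endo_adj f f" if adj: "\<And>n. endo_adj (X n) (X n)" and lim: "X \<longlonglongrightarrow> f" for X f
    unfolding endo_adj_def
  proof (intro allI)
    fix x y
    have "(\<lambda>n. ip (endo_app (X n) x) y) \<longlonglongrightarrow> ip (endo_app f x) y"
      by (intro tendsto_ip tendsto_endo_app lim tendsto_const)
    moreover have "(\<lambda>n. ip (endo_app (X n) x) y) \<longlonglongrightarrow> ip x (endo_app f y)"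
      unfolding endo_adjD[OF adj] by (intro tendsto_ip tendsto_endo_app lim tendsto_const)
    ultimately show "ip (endo_app f x) y = ip x (endo_app f y)"
      by (rule LIMSEQ_unique)
  qed
  show "(norm a)\<^sup>2 \<le> norm (b * a)" if adj: "endo_adj a b"
  proof -
    have "norm (endo_app a x) \<le> sqrt (norm (b * a)) * norm x" for x
    proof -
      have "(norm (endo_app a x))\<^sup>2 = norm (ip x (endo_app (b * a) x))"
        by (simp add: norm_ip_self[symmetric] endo_adjD[OF adj])
      also have "\<dots> \<le> norm x * (norm (b * a) * norm x)"
        by (rule order_trans[OF ip_bound]) (intro mult_left_mono norm_endo_app norm_ge_zero)
      also have "\<dots> = (sqrt (norm (b * a)) * norm x)\<^sup>2"
        by (simp add: power_mult_distrib power2_eq_square)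
      finally show ?thesis
        by (rule power2_le_imp_le) simp
    qed
    then have "norm a \<le> sqrt (norm (b * a))"
      by (intro norm_endo_bound) auto
    then have "(norm a)\<^sup>2 \<le> (sqrt (norm (b * a)))\<^sup>2"
      by (intro power_mono) auto
    then show ?thesis by simp
  qed
  show "endo_adj (endo_of (\<lambda>x. \<i> *\<^sub>C x)) (- endo_of (\<lambda>x. \<i> *\<^sub>C x))"
    unfolding endo_adj_def J
    by (simp add: ip_scaleC ip_scaleC_left ip_minus scaleC_minus_one scaleC_scaleC[symmetric])
       (metis mult_minus1 scaleC_minus_one scaleC_scaleC)
  show "endo_of (\<lambda>x. \<i> *\<^sub>C x) * endo_of (\<lambda>x. \<i> *\<^sub>C x) = - (1 :: 'h endo)"
    by (rule endo_eqI) (simp add: scaleC_scaleC scaleC_minus_one)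
  show "endo_of (\<lambda>x. \<i> *\<^sub>C x) * a = a * endo_of (\<lambda>x. \<i> *\<^sub>C x)" if "endo_adj a b"
  proof (rule endo_eqI, rule ip_eqI)
    fix x y
    show "ip (endo_app (endo_of (\<lambda>x. \<i> *\<^sub>C x) * a) x) y = ip (endo_app (a * endo_of (\<lambda>x. \<i> *\<^sub>C x)) x) y"
      by (simp add: ip_scaleC_left endo_adjD[OF that])
  qed
qed

end

section \<open>The order of a C*-algebra through left multiplications\<close>

interpretation cstar: ip_module "\<lambda>a b::'a::cstar_algebra. star a * b"
proof
  fix x y z :: 'a and c
  show "star x * (y + z) = star x * y + star x * z" by (simp add: distrib_left)
  show "star x * c *\<^sub>C y = c *\<^sub>C (star x * y)" by (rule scaleC_mult_right)
  show "star (star x * y) = star y * x" by (simp add: star_mult star_star)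
  show "norm x = sqrt (norm (star x * x))" by (simp add: cstar_identity)
  show "norm (star x * y) \<le> norm x * norm y" using norm_mult_ineq[of "star x" y] by simp
qed

definition left_mult :: "'a::cstar_algebra \<Rightarrow> 'a endo" where
  "left_mult a = endo_of (\<lambda>x. a * x)"

lemma left_mult_app [simp]: "endo_app (left_mult a) x = a * x"
  unfolding left_mult_def by (subst endo_app_endo_of) (simp_all add: bounded_linear_mult_right)

lemma left_mult_simps:
  "left_mult (a + b) = left_mult a + left_mult b"
  "left_mult (a - b) = left_mult a - left_mult b"
  "left_mult (a * b) = left_mult a * left_mult b"
  by (rule endo_eqI, simp add: algebra_simps)+

text \<open>The lower bound comes from evaluation at \<open>star a\<close> and the
  C*-identity.\<close>

lemma norm_left_mult [simp]: "norm (left_mult a) = norm (a::'a::cstar_algebra)"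
proof (rule antisym)
  show "norm (left_mult a) \<le> norm a"
    by (rule norm_endo_bound) (simp_all add: norm_mult_ineq)
  have "norm a * norm a \<le> norm (left_mult a) * norm a"
    using norm_endo_app[of "left_mult a" "star a"] cstar_identity[of "star a"]
    by (simp add: star_star power2_eq_square)
  then show "norm a \<le> norm (left_mult a)"
    by (cases "a = 0") (simp_all add: mult_le_cancel_right)
qed

lemma endo_adj_left_mult: "cstar.endo_adj (left_mult a) (left_mult (star a))"
  by (simp add: cstar.endo_adj_def star_mult mult.assoc)

text \<open>The endomorphisms supply the unit that \<open>pos\<close> refers to and that the algebra
  itself may not have.\<close>

definition nonneg :: "'a::cstar_algebra \<Rightarrow> bool" where
  "nonneg a \<longleftrightarrow> cstar.pos (left_mult a)"

lemma nonneg_star_mult: "nonneg (star a * a)"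
  unfolding nonneg_def left_mult_simps by (rule cstar.pos_adj_mult) (rule endo_adj_left_mult)

lemma nonneg_add: "nonneg a \<Longrightarrow> nonneg b \<Longrightarrow> nonneg (a + b)"
  unfolding nonneg_def left_mult_simps by (rule cstar.pos_add)

lemma nonneg_norm_mono: "nonneg a \<Longrightarrow> nonneg (b - a) \<Longrightarrow> norm a \<le> norm b"
  unfolding nonneg_def left_mult_simps using cstar.pos_norm_mono by fastforce

text \<open>In the endomorphisms this is the conjugate of the positive element \<open>1 - a\<close>
  by \<open>b\<close>; the statement is expanded because \<open>1\<close> need not exist in the
  algebra.\<close>

lemma nonneg_conj_contraction:
  assumes "star a = a" "norm a \<le> 1" shows "nonneg (star b * b - star b * a * b)"
proof -
  have "cstar.endo_adj (left_mult a) (left_mult a)"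
    using endo_adj_left_mult[of a] assms by simp
  then have "cstar.pos (1 - left_mult a)"
    using cstar.pos_one_minus[of "left_mult a" 1] assms by simp
  from cstar.pos_conj[OF this endo_adj_left_mult] show ?thesis
    unfolding nonneg_def left_mult_simps by (simp add: algebra_simps)
qed

section \<open>The Cauchy-Schwarz inequality in a Hilbert module\<close>

context hilbert_module
begin

sublocale ip_space ip
  by unfold_locales (simp_all add: ip_add_right ip_scaleC_right star_ip norm_eq_ip)

lemma nonneg_ip: "nonneg (ip x x)"
  using ip_positive[of x] nonneg_star_mult by (auto simp: cstar_positive_def)

lemma ip_act_left: "ip (act x a) y = star a * ip x y"
  by (metis ip_act_right star_ip star_mult)

text \<open>For \<open>norm y = 1\<close>, \<open>b = ip y x\<close> and
  \<open>z = x - act y b\<close>, the element \<open>ip x x - star b * b\<close> is the sum of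
  \<open>ip z z\<close> and \<open>star b * b - star b * ip y y * b\<close>, both nonnegative.
  Monotonicity of the norm gives \<open>norm b \<le> norm x\<close>.\<close>

lemma cauchy_schwarz: "norm (ip x y) \<le> norm x * norm y"
proof -
  have unit: "norm (ip y x) \<le> norm x" if y: "norm y = 1" for x y
  proof -
    define b where "b = ip y x"
    have sb: "star b = ip x y" by (simp add: b_def star_ip)
    define z where "z = x - act y b"
    have "norm (ip y y) \<le> 1" using y by (simp add: norm_ip_self)
    then have "nonneg (star b * b - star b * ip y y * b)"
      by (intro nonneg_conj_contraction star_ip)
    then have "nonneg (ip z z + (star b * b - star b * ip y y * b))"
      by (intro nonneg_add nonneg_ip)
    also have "ip z z + (star b * b - star b * ip y y * b) = ip x x - star b * b"
      by (simp add: z_def ip_diff ip_act_left ip_act_right sb[symmetric] b_def[symmetric] algebra_simps)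
    finally have "norm (star b * b) \<le> norm (ip x x)"
      using nonneg_norm_mono nonneg_star_mult by blast
    then show ?thesis
      by (simp add: cstar_identity norm_ip_self b_def power2_le_iff_abs_le)
  qed
  show ?thesis
  proof (cases "y = 0")
    case False
    have "norm (ip ((1 / norm y) *\<^sub>R y) x) \<le> norm x"
      using False by (intro unit) simp
    then have "norm (ip y x) \<le> norm x * norm y"
      using False by (simp add: ip_scaleR field_simps)
    then show ?thesis by (metis norm_star star_ip)
  qed simp
qed

sublocale ip_module ip
  by unfold_locales (rule cauchy_schwarz)

end

section \<open>Adjointable operators\<close>

text \<open>A relational adjoint, symmetric in \<open>T\<close> and \<open>S\<close> for Hilbert
  modules, avoids reasoning about the description in \<open>adj\<close>.\<close>

definition adjoint_pair :: "('h \<Rightarrow> 'h \<Rightarrow> 'a) \<Rightarrow> ('k \<Rightarrow> 'k \<Rightarrow> 'a) \<Rightarrow> ('h \<Rightarrow> 'k) \<Rightarrow> ('k \<Rightarrow> 'h) \<Rightarrow> bool" where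
  "adjoint_pair ipH ipK T S \<longleftrightarrow> (\<forall>x y. ipK (T x) y = ipH x (S y))"

lemma adjoint_pairD: "adjoint_pair ipH ipK T S \<Longrightarrow> ipK (T x) y = ipH x (S y)"
  by (simp add: adjoint_pair_def)

lemma adjoint_pair_adjointable: "adjoint_pair ipH ipK T S \<Longrightarrow> T \<in> adjointable ipH ipK"
  by (auto simp: adjoint_pair_def adjointable_def)

lemma adjoint_pair_comp:
  "adjoint_pair ipH ipK T S \<Longrightarrow> adjoint_pair ipK ipL T' S' \<Longrightarrow> adjoint_pair ipH ipL (T' \<circ> T) (S \<circ> S')"
  by (simp add: adjoint_pair_def)

locale hilbert_pair = H: hilbert_module actH ipH + K: hilbert_module actK ipK
  for actH :: "'h::complex_banach \<Rightarrow> 'a::cstar_algebra \<Rightarrow> 'h" and ipH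
    and actK :: "'k::complex_banach \<Rightarrow> 'a \<Rightarrow> 'k" and ipK
begin

lemma swap: "hilbert_pair actK ipK actH ipH"
  by intro_locales

lemma adjoint_pair_sym: "adjoint_pair ipH ipK T S \<Longrightarrow> adjoint_pair ipK ipH S T"
  unfolding adjoint_pair_def by (metis H.star_ip K.star_ip)

lemma adj_eq: assumes "adjoint_pair ipH ipK T S" shows "adj ipH ipK T = S"
  unfolding adj_def
proof (rule the_equality)
  show "\<forall>x y. ipK (T x) y = ipH x (S y)"
    using assms by (simp add: adjoint_pair_def)
  show "S' = S" if "\<forall>x y. ipK (T x) y = ipH x (S' y)" for S'
    by (rule ext, rule H.ip_eqI2) (use assms that in \<open>simp add: adjoint_pair_def\<close>)
qed

lemma adjoint_pair_adj:
  assumes "T \<in> adjointable ipH ipK" shows "adjoint_pair ipH ipK T (adj ipH ipK T)"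
proof -
  obtain S where "adjoint_pair ipH ipK T S"
    using assms by (auto simp: adjoint_pair_def adjointable_def)
  then show ?thesis by (simp add: adj_eq)
qed

lemma adjoint_pair_act:
  assumes "adjoint_pair ipH ipK T S" shows "T (actH x a) = actK (T x) a"
  by (rule K.ip_eqI) (simp add: adjoint_pairD[OF assms] H.ip_act_left K.ip_act_left)

lemma adjoint_pair_scaleC:
  assumes "adjoint_pair ipH ipK T S" shows "T (c *\<^sub>C x) = c *\<^sub>C T x"
  by (rule K.ip_eqI) (simp add: adjoint_pairD[OF assms] H.ip_scaleC_left K.ip_scaleC_left)

text \<open>Baire's theorem is applied to the closed sets of all \<open>x\<close> with \<open>\<parallel>\<langle>x, S y\<rangle>\<parallel> \<le> n \<parallel>y\<parallel>\<close> for every \<open>y\<close>.\<close>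
lemma adjoint_pair_bounded_linear:
  assumes adj: "adjoint_pair ipH ipK T S" shows "bounded_linear T"
proof -
  have add: "T (x + y) = T x + T y" for x y
    by (rule K.ip_eqI) (simp add: adjoint_pairD[OF adj] H.ip_add_left K.ip_add_left)
  have scale: "T (r *\<^sub>R x) = r *\<^sub>R T x" for r x
    by (rule K.ip_eqI) (simp add: adjoint_pairD[OF adj] H.ip_scaleR K.ip_scaleR)
  interpret T: linear T
    by unfold_locales (simp_all add: add scale)
  define B where "B n = {x. \<forall>y. norm (ipH x (S y)) \<le> real n * norm y}" for n
  have closed: "closed (B n)" for n
  proof -
    have "B n = (\<Inter>y. {x. norm (ipH x (S y)) \<le> real n * norm y})"
      by (auto simp: B_def)
    moreover have "closed {x. norm (ipH x (S y)) \<le> real n * norm y}" for y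
      by (intro closed_Collect_le continuous_intros
          bounded_linear.continuous_on[OF bounded_bilinear.bounded_linear_left[OF H.bounded_bilinear_ip]])
    ultimately show ?thesis by auto
  qed
  have cover: "(\<Union>n. B n) = UNIV"
  proof -
    have "\<exists>n. x \<in> B n" for x
    proof -
      obtain n where "norm (T x) \<le> real n" using real_arch_simple by blast
      then have "norm (ipH x (S y)) \<le> real n * norm y" for y
        using K.ip_bound[of "T x" y] mult_right_mono[of "norm (T x)" "real n" "norm y"]
        by (simp add: adjoint_pairD[OF adj])
      then show ?thesis by (auto simp: B_def)
    qed
    then show ?thesis by auto
  qed
  have "\<exists>n. interior (B n) \<noteq> {}"
  proof (rule ccontr)
    assume "\<not> ?thesis"
    then have "Met_TC.mtopology interior_of \<Union> (range B) = {}"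
      using closed by (intro Met_TC.metric_Baire_category_alt) (auto simp: complete_UNIV)
    then show False by (simp add: cover)
  qed
  then obtain n x0 e where e: "e > 0" "ball x0 e \<subseteq> B n"
    by (meson all_not_in_conv mem_interior)
  have bound: "norm (ipH x (S y)) \<le> (4 * real n / e) * norm x * norm y" for x y
  proof (cases "x = 0")
    case False
    \<comment> \<open>The vector \<open>c x\<close> has length \<open>e/2\<close>, so
      \<open>x0 + c x\<close> stays in the ball. Subtracting the bounds at the two points costs a
      factor 2, whence \<open>4 n / e\<close>.\<close>
    define c where "c = e / (2 * norm x)"
    have c: "c > 0" using e False by (simp add: c_def)
    have "norm (c *\<^sub>R x) < e" using e False by (simp add: c_def)
    then have "x0 + c *\<^sub>R x \<in> B n" "x0 \<in> B n"
      using e by (auto simp: subset_iff dist_norm)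
    then have "norm (ipH (x0 + c *\<^sub>R x) (S y)) + norm (ipH x0 (S y)) \<le> 2 * (real n * norm y)"
      unfolding B_def by (simp, metis add_mono mult_2)
    moreover have "c *\<^sub>R ipH x (S y) = ipH (x0 + c *\<^sub>R x) (S y) - ipH x0 (S y)"
      by (simp add: H.ip_add_left H.ip_scaleR)
    ultimately have "norm (c *\<^sub>R ipH x (S y)) \<le> 2 * (real n * norm y)"
      by (metis norm_triangle_ineq4 order_trans)
    then have "c * norm (ipH x (S y)) \<le> 2 * (real n * norm y)"
      using c by simp
    then have "norm (ipH x (S y)) \<le> 2 * (real n * norm y) / c"
      using c by (simp add: pos_le_divide_eq mult.commute)
    also have "\<dots> = (4 * real n / e) * norm x * norm y"
      by (simp add: c_def)
    finally show ?thesis .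
  qed simp
  show ?thesis
  proof (rule bounded_linear_intro[where K = "4 * real n / e"])
    fix x
    let ?C = "4 * real n / e"
    \<comment> \<open>At \<open>y = T x\<close> the bound on \<open>ipH x (S y)\<close> becomes one
      on the square of \<open>norm (T x)\<close>.\<close>
    have "norm (T x) * norm (T x) \<le> (?C * norm x) * norm (T x)"
      using bound[of x "T x"] by (simp add: adjoint_pairD[OF adj, symmetric] K.norm_ip_self power2_eq_square)
    moreover have "0 \<le> ?C * norm x" using e by simp
    ultimately have "norm (T x) \<le> ?C * norm x"
      using mult_right_le_imp_le[of "norm (T x)" "norm (T x)" "?C * norm x"] by (cases "T x = 0") auto
    then show "norm (T x) \<le> norm x * ?C" by (simp add: mult.commute)
  qed (simp_all add: add scale)
qed

lemma adjoint_pair_norm_bound: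
  assumes adj: "adjoint_pair ipH ipK T S" and b: "0 \<le> b" "\<And>x. norm (T x) \<le> b * norm x"
  shows "norm (S y) \<le> b * norm y"
proof -
  have "norm (S y) * norm (S y) = norm (ipK (T (S y)) y)"
    by (simp add: adjoint_pairD[OF adj] H.norm_ip_self power2_eq_square)
  also have "\<dots> \<le> (b * norm (S y)) * norm y"
    by (rule order_trans[OF K.ip_bound]) (intro mult_right_mono b norm_ge_zero)
  finally have "norm (S y) * norm (S y) \<le> (b * norm y) * norm (S y)"
    by (simp add: mult_ac)
  moreover have "0 \<le> b * norm y" using b by simp
  ultimately show ?thesis
    using mult_right_le_imp_le[of "norm (S y)" "norm (S y)" "b * norm y"] by (cases "S y = 0") auto
qed

lemma endo_app_adjoint_comp:
  assumes "adjoint_pair ipH ipK T S" shows "endo_app (endo_of (S \<circ> T)) = S \<circ> T"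
  using assms adjoint_pair_bounded_linear
    hilbert_pair.adjoint_pair_bounded_linear[OF swap adjoint_pair_sym]
  by (intro endo_app_endo_of) (auto simp: o_def intro: bounded_linear_compose)

text \<open>\<open>1 - S T\<close> has a self-adjoint square root \<open>R\<close>, and \<open>\<langle>x, x\<rangle> - \<langle>T x, T x\<rangle> = \<langle>R x, R x\<rangle>\<close>.\<close>
lemma nonneg_ip_contraction:
  assumes adj: "adjoint_pair ipH ipK T S" and T: "\<And>x. norm (T x) \<le> norm x"
  shows "nonneg (ipH x x - ipK (T x) (T x))"
proof -
  have S: "norm (S y) \<le> norm y" for y
    using adjoint_pair_norm_bound[OF adj, of 1] T by simp
  let ?A = "endo_of (S \<circ> T)"
  note A [simp] = endo_app_adjoint_comp[OF adj]
  have "H.endo_adj ?A ?A"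
    by (simp add: H.endo_adj_def adjoint_pairD[OF adj, symmetric]
        adjoint_pairD[OF adjoint_pair_sym[OF adj]])
  moreover have "norm ?A \<le> 1"
    by (rule norm_endo_bound) (use S T order_trans in \<open>fastforce+\<close>)
  ultimately obtain r where r: "H.endo_adj r r" "r * r = 1 - ?A"
    using H.sqrt_one_minus by blast
  have "ipH (endo_app r x) (endo_app r x) = ipH x (endo_app (r * r) x)"
    by (simp add: H.endo_adjD[OF r(1)])
  also have "\<dots> = ipH x x - ipK (T x) (T x)"
    by (simp add: r(2) H.ip_diff adjoint_pairD[OF adj])
  finally show ?thesis by (metis H.nonneg_ip)
qed

text \<open>\<open>pos_adj_mult\<close> lives in a single algebra, while \<open>T\<close> may join
  two modules. For a contraction \<open>T\<close> and \<open>b = S (T x)\<close>, the difference of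
  \<open>ipH x x\<close> and \<open>ipH (x - b) (x - b)\<close> is a sum of two nonnegative
  elements, so \<open>norm (1 - S T) \<le> 1\<close>; scaling gives the general case.\<close>

lemma pos_adjoint_comp:
  assumes adj: "adjoint_pair ipH ipK T S" shows "H.pos (endo_of (S \<circ> T))"
proof -
  have contraction: "H.pos (endo_of (S \<circ> T))"
    if adj: "adjoint_pair ipH ipK T S" and T: "\<And>x. norm (T x) \<le> norm x" for T S
  proof -
    have S: "norm (S y) \<le> norm y" for y
      using adjoint_pair_norm_bound[OF adj, of 1] T by simp
    let ?A = "endo_of (S \<circ> T)"
    note A [simp] = endo_app_adjoint_comp[OF adj]
    note adj' = adjoint_pair_sym[OF adj]
    have "norm (x - S (T x)) \<le> norm x" for x
    proof -
      let ?b = "S (T x)"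
      have TT: "ipH x ?b = ipK (T x) (T x)" "ipH ?b x = ipK (T x) (T x)"
        by (simp_all add: adjoint_pairD[OF adj] adjoint_pairD[OF adj'])
      have "nonneg (ipK (T x) (T x) - ipH ?b ?b)"
        using hilbert_pair.nonneg_ip_contraction[OF swap adj' S] .
      then have "nonneg (ipK (T x) (T x) - ipH ?b ?b + ipK (T x) (T x))"
        by (intro nonneg_add K.nonneg_ip)
      also have "ipK (T x) (T x) - ipH ?b ?b + ipK (T x) (T x) = ipH x x - ipH (x - ?b) (x - ?b)"
        by (simp add: H.ip_diff TT)
      finally have "norm (ipH (x - ?b) (x - ?b)) \<le> norm (ipH x x)"
        by (intro nonneg_norm_mono H.nonneg_ip)
      then show ?thesis by (simp add: H.norm_ip_self power2_le_iff_abs_le)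
    qed
    then have "norm (1 - ?A) \<le> 1"
      by (intro norm_endo_bound) simp_all
    moreover have "H.endo_adj ?A ?A"
      by (simp add: H.endo_adj_def adjoint_pairD[OF adj, symmetric] adjoint_pairD[OF adj'])
    ultimately show ?thesis
      unfolding H.pos_def by (auto intro!: exI[of _ 1])
  qed
  obtain c where c: "c > 0" "\<And>x. norm (T x) \<le> norm x * c"
    using bounded_linear.pos_bounded[OF adjoint_pair_bounded_linear[OF adj]] by blast
  let ?T = "\<lambda>x. (1 / c) *\<^sub>R T x" and ?S = "\<lambda>y. (1 / c) *\<^sub>R S y"
  have "adjoint_pair ipH ipK ?T ?S"
    using adj by (simp add: adjoint_pair_def H.ip_scaleR K.ip_scaleR)
  moreover have "norm (?T x) \<le> norm x" for x
    using c by (simp add: field_simps)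
  ultimately have "H.pos (endo_of (?S \<circ> ?T))" and app: "endo_app (endo_of (?S \<circ> ?T)) = ?S \<circ> ?T"
    by (auto simp: contraction endo_app_adjoint_comp)
  moreover have "endo_of (S \<circ> T) = c\<^sup>2 *\<^sub>R endo_of (?S \<circ> ?T)"
  proof (rule endo_eqI)
    fix x
    have "S ((1 / c) *\<^sub>R T x) = (1 / c) *\<^sub>R S (T x)"
      by (rule linear_cmul, rule bounded_linear.linear,
          rule hilbert_pair.adjoint_pair_bounded_linear[OF swap adjoint_pair_sym[OF adj]])
    then show "endo_app (endo_of (S \<circ> T)) x = endo_app (c\<^sup>2 *\<^sub>R endo_of (?S \<circ> ?T)) x"
      using c by (simp add: app endo_app_adjoint_comp[OF adj] power2_eq_square)
  qed
  ultimately show ?thesis by (simp add: H.pos_scaleR)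
qed

end

section \<open>Operator positivity and operator square roots\<close>

context hilbert_module
begin

lemma hilbert_pair_self: "hilbert_pair act ip act ip"
  by intro_locales

lemma endo_adj_imp_adjoint_pair: "endo_adj f g \<Longrightarrow> adjoint_pair ip ip (endo_app f) (endo_app g)"
  by (simp add: endo_adj_def adjoint_pair_def)

text \<open>A positive root of \<open>s\<close> serves as \<open>R\<close>, and conversely
  \<open>pos_adjoint_comp\<close> applies to \<open>R\<close>. Uniqueness of roots for
  \<open>pos\<close> thereby determines \<open>op_sqrt\<close>.\<close>

lemma op_positive_iff: "op_positive ip S \<longleftrightarrow> (\<exists>s. pos s \<and> S = endo_app s)"
proof
  interpret self: hilbert_pair act ip act ip by (rule hilbert_pair_self)
  assume "op_positive ip S"
  then obtain R where R: "adjoint_pair ip ip R (adj ip ip R)" "S = adj ip ip R \<circ> R"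
    using self.adjoint_pair_adj by (auto simp: op_positive_def)
  then show "\<exists>s. pos s \<and> S = endo_app s"
    using self.pos_adjoint_comp[OF R(1)] self.endo_app_adjoint_comp[OF R(1)] by metis
next
  interpret self: hilbert_pair act ip act ip by (rule hilbert_pair_self)
  assume "\<exists>s. pos s \<and> S = endo_app s"
  then obtain s r where s: "S = endo_app s" and r: "pos r" "r * r = s"
    using pos_sqrt by blast
  have pair: "adjoint_pair ip ip (endo_app r) (endo_app r)"
    by (intro endo_adj_imp_adjoint_pair pos_sa r)
  have "S = adj ip ip (endo_app r) \<circ> endo_app r"
    by (simp add: self.adj_eq[OF pair] s r(2)[symmetric] fun_eq_iff)
  then show "op_positive ip S"
    using adjoint_pair_adjointable[OF pair] by (auto simp: op_positive_def)
qed

lemma op_sqrt_eq: assumes "pos s" shows "op_sqrt ip (endo_app s \<circ> endo_app s) = endo_app s"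
  unfolding op_sqrt_def
proof (rule the_equality)
  show "op_positive ip (endo_app s) \<and> endo_app s \<circ> endo_app s = endo_app s \<circ> endo_app s"
    using assms by (auto simp: op_positive_iff)
  fix S assume S: "op_positive ip S \<and> S \<circ> S = endo_app s \<circ> endo_app s"
  then obtain s' where s': "pos s'" "S = endo_app s'"
    by (auto simp: op_positive_iff)
  have "s' * s' = s * s"
    by (rule endo_eqI) (use S s' in \<open>simp add: fun_eq_iff\<close>)
  then have "s' = s"
    by (rule pos_sqrt_unique[OF s'(1) assms])
  then show "S = endo_app s" using s' by simp
qed

end

section \<open>Polar decomposition\<close>

lemma equibounded_approx:
  fixes f :: "nat \<Rightarrow> 'a::real_normed_vector \<Rightarrow> 'b::real_normed_vector"
  assumes b: "\<And>n x. norm (f n x) \<le> b * norm x" and x: "x \<in> closure A" and e: "e > 0"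
  obtains a where "a \<in> A" "\<And>n. norm (f n (x - a)) < e"
proof -
  \<comment> \<open>The added 1 keeps the denominator positive, also for
    \<open>b = 0\<close>.\<close>
  define d where "d = e / (\<bar>b\<bar> + 1)"
  have b1: "\<bar>b\<bar> + 1 > 0" by simp
  then have "d > 0" using e by (simp add: d_def)
  then obtain a where a: "a \<in> A" "dist a x < d"
    using x by (meson closure_approachable)
  have "norm (f n (x - a)) < e" for n
  proof -
    have "norm (f n (x - a)) \<le> b * norm (x - a)" by (rule b)
    also have "\<dots> \<le> (\<bar>b\<bar> + 1) * norm (x - a)" by (intro mult_right_mono) auto
    also have "\<dots> < (\<bar>b\<bar> + 1) * d"
      using a by (intro mult_strict_left_mono) (auto simp: dist_norm norm_minus_commute)
    also have "\<dots> = e" using b1 unfolding d_def by (simp only: times_divide_eq_right) simp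
    finally show ?thesis .
  qed
  with a(1) show thesis by (rule that)
qed

lemma tendsto_zero_closure:
  fixes f :: "nat \<Rightarrow> 'a::real_normed_vector \<Rightarrow> 'b::real_normed_vector"
  assumes lin: "\<And>n. linear (f n)" and b: "\<And>n x. norm (f n x) \<le> b * norm x"
    and A: "\<And>a. a \<in> A \<Longrightarrow> (\<lambda>n. f n a) \<longlonglongrightarrow> 0" and x: "x \<in> closure A"
  shows "(\<lambda>n. f n x) \<longlonglongrightarrow> 0"
proof (rule tendstoI)
  fix e :: real assume e: "e > 0"
  then have "e / 2 > 0" by simp
  then obtain a where a: "a \<in> A" and small: "\<And>n. norm (f n (x - a)) < e / 2"
    using equibounded_approx[where f = f, OF b x] by blast
  have "\<forall>\<^sub>F n in sequentially. norm (f n a) < e / 2"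
    using tendstoD[OF A[OF a], of "e / 2"] e by (simp add: dist_norm)
  then show "\<forall>\<^sub>F n in sequentially. dist (f n x) 0 < e"
  proof eventually_elim
    case (elim n)
    have "f n x = f n (x - a) + f n a"
      by (simp add: linear_diff[OF lin])
    then show ?case
      using norm_triangle_ineq[of "f n (x - a)" "f n a"] small[of n] elim by simp
  qed
qed

lemma Cauchy_closure:
  fixes f :: "nat \<Rightarrow> 'a::real_normed_vector \<Rightarrow> 'b::real_normed_vector"
  assumes lin: "\<And>n. linear (f n)" and b: "\<And>n x. norm (f n x) \<le> b * norm x"
    and A: "\<And>a. a \<in> A \<Longrightarrow> Cauchy (\<lambda>n. f n a)" and x: "x \<in> closure A"
  shows "Cauchy (\<lambda>n. f n x)"
proof (rule metric_CauchyI)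
  fix e :: real assume e: "e > 0"
  then have "e / 3 > 0" by simp
  then obtain a where a: "a \<in> A" and small: "\<And>n. norm (f n (x - a)) < e / 3"
    using equibounded_approx[where f = f, OF b x] by blast
  obtain M where M: "\<And>m n. m \<ge> M \<Longrightarrow> n \<ge> M \<Longrightarrow> dist (f m a) (f n a) < e / 3"
    using metric_CauchyD[OF A[OF a], of "e / 3"] e by auto
  have "dist (f m x) (f n x) < e" if "m \<ge> M" "n \<ge> M" for m n
  proof -
    have "f m x - f n x = f m (x - a) + (f m a - f n a) - f n (x - a)"
      by (simp add: linear_diff[OF lin])
    then have "norm (f m x - f n x) \<le> norm (f m (x - a) + (f m a - f n a)) + norm (f n (x - a))"
      by (simp only: norm_triangle_ineq4)
    moreover have "norm (f m (x - a) + (f m a - f n a)) \<le> norm (f m (x - a)) + norm (f m a - f n a)"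
      by (rule norm_triangle_ineq)
    ultimately show ?thesis
      using small[of m] small[of n] M[OF that] unfolding dist_norm by linarith
  qed
  then show "\<exists>M. \<forall>m\<ge>M. \<forall>n\<ge>M. dist (f m x) (f n x) < e" by blast
qed

section \<open>Projections onto complemented submodules\<close>

context hilbert_module
begin

context
  fixes M assumes M: "orthogonally_complemented act ip M"
begin

lemma proj_onto_spec: "proj_onto ip M x \<in> M \<and> x - proj_onto ip M x \<in> orth_compl ip M"
  unfolding proj_onto_def
proof (rule theI')
  obtain m n where mn: "m \<in> M" "n \<in> orth_compl ip M" "x = m + n"
    using M unfolding orthogonally_complemented_def by blast
  show "\<exists>!m. m \<in> M \<and> x - m \<in> orth_compl ip M"
  proof (rule ex1I[of _ m])
    show "m \<in> M \<and> x - m \<in> orth_compl ip M" using mn by simp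
    fix m' assume m': "m' \<in> M \<and> x - m' \<in> orth_compl ip M"
    \<comment> \<open>Differences are formed with the scalar \<open>-1\<close>, as
      \<open>closed_submodule\<close> only provides sums and multiples. The difference of two
      candidates lies in \<open>M\<close> and in its complement.\<close>
    have "m' + (- 1) *\<^sub>C m \<in> M"
      using M m' mn(1) unfolding orthogonally_complemented_def closed_submodule_def by blast
    then have 1: "m' - m \<in> M" by (simp add: scaleC_minus_one)
    have "m' - m = n - (x - m')" by (simp add: mn(3))
    then have "m' - m \<in> orth_compl ip M"
      using m' mn(2) unfolding orth_compl_def by (simp only: mem_Collect_eq ip_diff(2)) simp
    with 1 M have "m' - m = 0"
      unfolding orthogonally_complemented_def by blast
    then show "m' = m" by simp
  qed
qed

lemma proj_onto_mem: "proj_onto ip M x \<in> M"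
  using proj_onto_spec by blast

lemma ip_proj_onto_diff:
  assumes "m \<in> M" shows "ip (x - proj_onto ip M x) m = 0" "ip m (x - proj_onto ip M x) = 0"
proof -
  show "ip (x - proj_onto ip M x) m = 0"
    using proj_onto_spec assms by (auto simp: orth_compl_def)
  then show "ip m (x - proj_onto ip M x) = 0" by (metis star_ip star_zero)
qed

lemma proj_onto_eqI:
  assumes "m \<in> M" "\<And>y. y \<in> M \<Longrightarrow> ip (x - m) y = 0" shows "proj_onto ip M x = m"
proof -
  have "proj_onto ip M x + (- 1) *\<^sub>C m \<in> M"
    using M assms(1) proj_onto_mem[of x]
    unfolding orthogonally_complemented_def closed_submodule_def by blast
  then have *: "proj_onto ip M x - m \<in> M" by (simp add: scaleC_minus_one)
  have "proj_onto ip M x - m = (x - m) - (x - proj_onto ip M x)" by simp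
  then have "ip (proj_onto ip M x - m) (proj_onto ip M x - m) = 0"
    using assms(2)[OF *] ip_proj_onto_diff(1)[OF *, of x] by (metis diff_0_right ip_diff(2))
  then show ?thesis using ip_self_eq_0 by fastforce
qed

lemma proj_onto_id: "m \<in> M \<Longrightarrow> proj_onto ip M m = m"
  by (rule proj_onto_eqI) simp_all

lemma ip_proj_onto:
  "ip (proj_onto ip M x) y = ip (proj_onto ip M x) (proj_onto ip M y)"
  "ip x (proj_onto ip M y) = ip (proj_onto ip M x) (proj_onto ip M y)"
  using ip_proj_onto_diff(2)[OF proj_onto_mem[of x], of y]
    ip_proj_onto_diff(1)[OF proj_onto_mem[of y], of x]
  by (simp_all add: ip_diff)

lemma is_projection_proj_onto: "is_projection ip (proj_onto ip M)"
proof -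
  interpret self: hilbert_pair act ip act ip by (rule hilbert_pair_self)
  have "adjoint_pair ip ip (proj_onto ip M) (proj_onto ip M)"
    unfolding adjoint_pair_def
    by (intro allI trans[OF ip_proj_onto(1) ip_proj_onto(2)[symmetric]])
  then show ?thesis
    unfolding is_projection_def
    by (auto simp: self.adj_eq fun_eq_iff proj_onto_id proj_onto_mem intro: adjoint_pair_adjointable)
qed

end

end

section \<open>Approximate inverses of the modulus\<close>

locale polar = hilbert_pair actH ipH actK ipK
  for actH :: "'h::complex_banach \<Rightarrow> 'a::cstar_algebra \<Rightarrow> 'h" and ipH
    and actK :: "'k::complex_banach \<Rightarrow> 'a \<Rightarrow> 'k" and ipK +
  fixes T :: "'h \<Rightarrow> 'k" and Ts :: "'k \<Rightarrow> 'h" and s :: "'h endo"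
  assumes pair: "adjoint_pair ipH ipK T Ts"
    and pos_s: "H.pos s"
    and s_square: "endo_app s (endo_app s x) = Ts (T x)"
begin

lemmas pair' = adjoint_pair_sym[OF pair]
lemmas bl_T = adjoint_pair_bounded_linear[OF pair]
lemmas bl_Ts = hilbert_pair.adjoint_pair_bounded_linear[OF swap pair']

lemmas sa_s = H.pos_sa[OF pos_s]
lemmas ip_s = H.endo_adjD[OF sa_s]

lemma ip_T: "ipK (T x) (T y) = ipH (endo_app s x) (endo_app s y)"
  by (simp add: adjoint_pairD[OF pair] ip_s s_square)

lemma norm_T: "norm (T x) = norm (endo_app s x)"
  by (simp add: K.ip_norm H.ip_norm ip_T)

text \<open>Here \<open>s\<close> plays the part of the modulus of \<open>T\<close>. Division by
  \<open>norm s + 1\<close> makes sense for \<open>s = 0\<close> too and makes \<open>g\<close> a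
  positive contraction; \<open>q n\<close> is the error in \<open>s * r n = 1 - q n\<close>.\<close>

definition g where "g = (1 / (norm s + 1)) *\<^sub>R s"
definition q where "q n = (1 - g) ^ n"
definition r where "r n = (1 / (norm s + 1)) *\<^sub>R (\<Sum>k<n. q k)"

lemma t_pos: "norm s + 1 > 0"
  by (simp add: add_nonneg_pos)

lemma pos_g: "H.pos g"
  unfolding g_def using t_pos by (intro H.pos_scaleR pos_s) auto

lemma norm_g: "norm g \<le> 1"
  using t_pos by (simp add: g_def)

lemma norm_q: "norm (q n) \<le> 1"
proof -
  have "H.pos (1 - g)"
    using H.pos_one_minus[OF H.pos_sa[OF pos_g] norm_g] by simp
  then have "norm (1 - g) \<le> 1"
    by (rule H.pos_norm_le) (simp_all add: pos_g)
  then show ?thesis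
    unfolding q_def by (rule H.norm_power_le_one)
qed

lemma sa_q: "H.endo_adj (q n) (q n)"
  unfolding q_def by (intro H.isadj_power H.isadj_diff H.isadj_one H.pos_sa pos_g)

lemma sa_r: "H.endo_adj (r n) (r n)"
  unfolding r_def by (intro H.isadj_scaleR H.isadj_sum sa_q)

lemma s_commute_q: "s * q n = q n * s"
  unfolding q_def by (intro H.commute_power) (simp add: g_def algebra_simps)

lemma s_mult_r: "s * r n = 1 - q n"
proof -
  have "g * (\<Sum>k<n. q k) = 1 - q n"
    by (induction n) (simp_all add: q_def algebra_simps)
  then show ?thesis by (simp add: r_def g_def)
qed

lemma r_mult_s: "r n * s = 1 - q n"
proof -
  have "s * (\<Sum>k<n. q k) = (\<Sum>k<n. q k) * s"
    by (simp add: sum_distrib_left sum_distrib_right s_commute_q)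
  then have "r n * s = s * r n" by (simp add: r_def)
  then show ?thesis by (simp add: s_mult_r)
qed

lemma s_r_app: "endo_app s (endo_app (r n) x) = x - endo_app (q n) x"
  using arg_cong[OF s_mult_r, of "\<lambda>f. endo_app f x" n] by simp

lemma r_s_app: "endo_app (r n) (endo_app s x) = x - endo_app (q n) x"
  using arg_cong[OF r_mult_s, of "\<lambda>f. endo_app f x" n] by simp

lemma s_q_app: "endo_app s (endo_app (q n) x) = endo_app (q n) (endo_app s x)"
  using arg_cong[OF s_commute_q, of "\<lambda>f. endo_app f x" n] by simp

text \<open>The rate is uniform in \<open>x\<close>, so it passes to adjoints.\<close>

lemma norm_s_q: "norm (endo_app s (endo_app (q n) x)) \<le> (norm s + 1) / real (Suc n) * norm x"
proof -
  have "s * q n = (norm s + 1) *\<^sub>R (g * (1 - g) ^ n)"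
    using t_pos by (simp add: g_def q_def)
  then have "norm (s * q n) = (norm s + 1) * norm (g * (1 - g) ^ n)"
    using t_pos by simp
  also have "\<dots> \<le> (norm s + 1) * (1 / real (Suc n))"
    using t_pos by (intro mult_left_mono H.norm_mult_power_one_minus_le pos_g norm_g) auto
  finally have "norm (s * q n) * norm x \<le> (norm s + 1) / real (Suc n) * norm x"
    by (intro mult_right_mono) auto
  then show ?thesis
    using norm_endo_app[of "s * q n" x] by simp
qed

lemma null_bound: "(\<lambda>n. (norm s + 1) / real (Suc n) * c) \<longlonglongrightarrow> 0"
  using tendsto_mult_left_zero[OF LIMSEQ_Suc[OF lim_const_over_n[of "norm s + 1"]], of c] by simp

lemma s_q_null: "(\<lambda>n. endo_app s (endo_app (q n) x)) \<longlonglongrightarrow> 0"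
  by (rule Lim_null_comparison[OF _ null_bound[of "norm x"]]) (intro always_eventually allI norm_s_q)

lemma T_q_null: "(\<lambda>n. T (endo_app (q n) x)) \<longlonglongrightarrow> 0"
  by (rule Lim_null_comparison[OF _ null_bound[of "norm x"]], unfold norm_T)
     (intro always_eventually allI norm_s_q)

lemma q_closure_null: "x \<in> closure (range (endo_app s)) \<Longrightarrow> (\<lambda>n. endo_app (q n) x) \<longlonglongrightarrow> 0"
proof (rule tendsto_zero_closure[where b = 1])
  show "linear (endo_app (q n))" for n
    by (rule bounded_linear.linear[OF bounded_linear_endo_app])
  show "norm (endo_app (q n) x) \<le> 1 * norm x" for n x
    using norm_endo_app[of "q n" x] mult_right_mono[OF norm_q[of n], of "norm x"] by simp
  show "(\<lambda>n. endo_app (q n) a) \<longlonglongrightarrow> 0" if "a \<in> range (endo_app s)" for a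
    using that s_q_null by (auto simp: s_q_app)
qed

lemma q_kernel: assumes "endo_app s x = 0" shows "endo_app (q n) x = x"
proof (induction n)
  case (Suc n)
  have "q (Suc n) = (1 - g) * q n" by (simp add: q_def)
  then have "endo_app (q (Suc n)) x = x - endo_app g x" using Suc by simp
  then show ?case by (simp add: g_def assms)
qed (simp add: q_def)

text \<open>\<open>q n\<close> after \<open>Ts\<close> is the adjoint of \<open>T\<close> after
  \<open>q n\<close>, which obeys the norm bound for \<open>s * q n\<close> because
  \<open>T x\<close> and \<open>s x\<close> have equal norms.\<close>

lemma q_Ts_null: "(\<lambda>n. endo_app (q n) (Ts y)) \<longlonglongrightarrow> 0"
proof (rule Lim_null_comparison[OF _ null_bound], intro always_eventually allI)
  fix n
  have "adjoint_pair ipH ipK (T \<circ> endo_app (q n)) (endo_app (q n) \<circ> Ts)"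
    by (rule adjoint_pair_comp[OF H.endo_adj_imp_adjoint_pair[OF sa_q] pair])
  then have "norm ((endo_app (q n) \<circ> Ts) y) \<le> (norm s + 1) / real (Suc n) * norm y"
    by (rule adjoint_pair_norm_bound) (simp_all only: o_apply norm_T norm_s_q, use t_pos in simp)
  then show "norm (endo_app (q n) (Ts y)) \<le> (norm s + 1) / real (Suc n) * norm y" by simp
qed

text \<open>One inclusion: \<open>s x\<close> is the limit of \<open>s (1 - q n) x\<close>, which
  equals \<open>Ts (T (r n x))\<close>. The other: \<open>Ts y\<close> is the limit of
  \<open>(1 - q n) (Ts y)\<close>, which lies in the range of \<open>s\<close>.\<close>

lemma closure_range_s: "closure (range (endo_app s)) = closure (range Ts)"
proof (rule antisym; rule closure_minimal; (rule closed_closure)?)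
  show "range (endo_app s) \<subseteq> closure (range Ts)"
  proof
    fix z assume "z \<in> range (endo_app s)"
    then obtain x where z: "z = endo_app s x" by blast
    have "(\<lambda>n. endo_app s x - endo_app s (endo_app (q n) x)) \<longlonglongrightarrow> endo_app s x - 0"
      by (intro tendsto_intros s_q_null)
    moreover have "endo_app s x - endo_app s (endo_app (q n) x) = Ts (T (endo_app (r n) x))" for n
      by (simp add: s_square[symmetric] s_r_app endo_app_linear)
    ultimately show "z \<in> closure (range Ts)"
      unfolding closure_sequential z by (intro exI[of _ "\<lambda>n. Ts (T (endo_app (r n) x))"]) simp
  qed
  show "range Ts \<subseteq> closure (range (endo_app s))"
  proof
    fix z assume "z \<in> range Ts"
    then obtain y where z: "z = Ts y" by blast
    have "(\<lambda>n. Ts y - endo_app (q n) (Ts y)) \<longlonglongrightarrow> Ts y - 0"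
      by (intro tendsto_intros q_Ts_null)
    moreover have "Ts y - endo_app (q n) (Ts y) = endo_app s (endo_app (r n) (Ts y))" for n
      by (simp add: s_r_app)
    ultimately show "z \<in> closure (range (endo_app s))"
      unfolding closure_sequential z
      by (intro exI[of _ "\<lambda>n. endo_app s (endo_app (r n) (Ts y))"]) simp
  qed
qed

section \<open>Existence of the polar decomposition\<close>

abbreviation M where "M \<equiv> closure (range Ts)"
abbreviation P where "P \<equiv> proj_onto ipH M"

context
  assumes compl: "orthogonally_complemented actH ipH M"
begin

lemma s_in_M: "endo_app s x \<in> M"
  using closure_subset[of "range (endo_app s)"] closure_range_s by auto

lemma s_proj_diff: "endo_app s (x - P x) = 0"
proof (rule H.ip_eqI)
  show "ipH (endo_app s (x - P x)) y = ipH 0 y" for y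
    using H.ip_proj_onto_diff(1)[OF compl s_in_M] by (simp add: ip_s)
qed

lemma s_proj: "endo_app s (P x) = endo_app s x"
  using s_proj_diff[of x] by (simp add: endo_app_linear)

text \<open>In \<open>x = P x + (x - P x)\<close> the first part is driven to 0 by
  \<open>q n\<close> and the second, a kernel vector of \<open>s\<close>, is fixed.\<close>

lemma q_limit: "(\<lambda>n. endo_app (q n) x) \<longlonglongrightarrow> x - P x"
proof -
  have "(\<lambda>n. endo_app (q n) (P x) + (x - P x)) \<longlonglongrightarrow> 0 + (x - P x)"
    using H.proj_onto_mem[OF compl] closure_range_s
    by (intro tendsto_intros q_closure_null) auto
  moreover have "endo_app (q n) (P x) + (x - P x) = endo_app (q n) x" for n
    using q_kernel[OF s_proj_diff[of x], of n] by (simp add: endo_app_linear algebra_simps)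
  ultimately show ?thesis by simp
qed

lemma s_r_limit: "(\<lambda>n. endo_app s (endo_app (r n) x)) \<longlonglongrightarrow> P x"
  using tendsto_diff[OF tendsto_const q_limit, of x x] by (simp add: s_r_app)

lemma r_s_limit: "(\<lambda>n. endo_app (r n) (endo_app s x)) \<longlonglongrightarrow> P x"
  using tendsto_diff[OF tendsto_const q_limit, of x x] by (simp add: r_s_app)

lemma Cauchy_T_r: "Cauchy (\<lambda>n. T (endo_app (r n) x))"
proof -
  have "dist (T u) (T v) = dist (endo_app s u) (endo_app s v)" for u v
    by (simp add: dist_norm linear_diff[OF bounded_linear.linear[OF bl_T], symmetric]
        endo_app_linear(2)[symmetric] norm_T)
  then show ?thesis
    using LIMSEQ_imp_Cauchy[OF s_r_limit[of x]] by (simp add: Cauchy_def)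
qed

text \<open>\<open>U\<close> is the pointwise limit of \<open>T\<close> after \<open>r n\<close>,
  which always exists; the hypothesis supplies the limit \<open>V\<close> of the adjoints, and
  adjointness survives the limit.\<close>

lemma polar_decomposition:
  assumes V: "\<And>y. Cauchy (\<lambda>n. endo_app (r n) (Ts y))"
  shows "\<exists>U. partial_isometry ipH ipK U \<and> T = U \<circ> endo_app s \<and> adj ipH ipK U \<circ> U = P"
proof -
  define U where "U x = lim (\<lambda>n. T (endo_app (r n) x))" for x
  define V where "V y = lim (\<lambda>n. endo_app (r n) (Ts y))" for y
  have U_lim: "(\<lambda>n. T (endo_app (r n) x)) \<longlonglongrightarrow> U x" for x
    unfolding U_def using Cauchy_T_r Cauchy_convergent_iff convergent_LIMSEQ_iff by blast
  have V_lim: "(\<lambda>n. endo_app (r n) (Ts y)) \<longlonglongrightarrow> V y" for y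
    unfolding V_def using assms Cauchy_convergent_iff convergent_LIMSEQ_iff by blast
  have UV: "adjoint_pair ipH ipK U V"
    unfolding adjoint_pair_def
  proof (intro allI)
    fix x y
    have "(\<lambda>n. ipK (T (endo_app (r n) x)) y) \<longlonglongrightarrow> ipK (U x) y"
      by (intro K.tendsto_ip U_lim tendsto_const)
    moreover have "(\<lambda>n. ipK (T (endo_app (r n) x)) y) \<longlonglongrightarrow> ipH x (V y)"
      unfolding adjoint_pairD[OF pair] H.endo_adjD[OF sa_r]
      by (intro H.tendsto_ip V_lim tendsto_const)
    ultimately show "ipK (U x) y = ipH x (V y)" by (rule LIMSEQ_unique)
  qed
  have "U (endo_app s x) = T x" for x
  proof (rule LIMSEQ_unique[OF U_lim])
    have "(\<lambda>n. T x - T (endo_app (q n) x)) \<longlonglongrightarrow> T x - 0"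
      by (intro tendsto_intros T_q_null)
    then show "(\<lambda>n. T (endo_app (r n) (endo_app s x))) \<longlonglongrightarrow> T x"
      by (simp add: r_s_app linear_diff[OF bounded_linear.linear[OF bl_T]])
  qed
  then have TU: "T = U \<circ> endo_app s" by auto
  \<comment> \<open>By \<open>ip_T\<close> the inner products of the images under \<open>T\<close>
    are those under \<open>s\<close>, and \<open>s (r n x)\<close> tends to
    \<open>P x\<close>.\<close>
  have "V (U x) = P x" for x
  proof (rule H.ip_eqI2)
    fix y
    have "(\<lambda>n. ipK (T (endo_app (r n) y)) (T (endo_app (r n) x))) \<longlonglongrightarrow> ipK (U y) (U x)"
      by (intro K.tendsto_ip U_lim)
    moreover have "(\<lambda>n. ipK (T (endo_app (r n) y)) (T (endo_app (r n) x))) \<longlonglongrightarrow> ipH (P y) (P x)"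
      unfolding ip_T by (intro H.tendsto_ip s_r_limit)
    ultimately have "ipK (U y) (U x) = ipH (P y) (P x)" by (rule LIMSEQ_unique)
    then show "ipH y (V (U x)) = ipH y (P x)"
      by (simp only: adjoint_pairD[OF UV] H.ip_proj_onto(2)[OF compl, of y x])
  qed
  then have "adj ipH ipK U \<circ> U = P"
    by (auto simp: adj_eq[OF UV])
  with TU show ?thesis
    unfolding partial_isometry_def
    using adjoint_pair_adjointable[OF UV] H.is_projection_proj_onto[OF compl] by metis
qed

text \<open>On the range of \<open>T\<close> the vector \<open>r n (Ts (T x))\<close> is
  \<open>r n (s (s x))\<close> and converges. Equiboundedness extends the Cauchy property to the
  closure, and \<open>Ts\<close> vanishes on the complement.\<close>

lemma polar_of_complemented:
  assumes "orthogonally_complemented actK ipK (closure (range T))"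
  shows "\<exists>U. partial_isometry ipH ipK U \<and> T = U \<circ> endo_app s \<and> adj ipH ipK U \<circ> U = P"
proof (rule polar_decomposition)
  fix y
  let ?Q = "proj_onto ipK (closure (range T))"
  \<comment> \<open>The left side is the norm of \<open>x - q n x\<close>, and \<open>q n\<close> is
    a contraction.\<close>
  have "norm (T (endo_app (r n) x)) \<le> 2 * norm x" for n x
    using norm_triangle_ineq4[of x "endo_app (q n) x"] norm_endo_app[of "q n" x]
      mult_right_mono[OF norm_q[of n], of "norm x"]
    by (simp add: norm_T s_r_app)
  then have bound: "norm (endo_app (r n) (Ts y)) \<le> 2 * norm y" for n y
    using adjoint_pair_norm_bound[OF adjoint_pair_comp[OF H.endo_adj_imp_adjoint_pair[OF sa_r] pair], of 2]
    by simp
  have "Cauchy (\<lambda>n. endo_app (r n) (Ts (?Q y)))"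
  proof (rule Cauchy_closure[where f = "\<lambda>n y. endo_app (r n) (Ts y)"])
    show "linear (\<lambda>y. endo_app (r n) (Ts y))" for n
      by (intro bounded_linear.linear bounded_linear_compose[OF bounded_linear_endo_app bl_Ts])
    show "norm (endo_app (r n) (Ts y)) \<le> 2 * norm y" for n y by (rule bound)
    show "?Q y \<in> closure (range T)" by (rule K.proj_onto_mem[OF assms])
    show "Cauchy (\<lambda>n. endo_app (r n) (Ts a))" if "a \<in> range T" for a
      using that LIMSEQ_imp_Cauchy[OF r_s_limit] by (auto simp: s_square[symmetric])
  qed
  moreover have "Ts (y - ?Q y) = 0"
  proof (rule H.ip_eqI2)
    fix x
    have "T x \<in> closure (range T)" using closure_subset[of "range T"] by auto
    then have "ipK (T x) (y - ?Q y) = 0"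
      by (rule K.ip_proj_onto_diff(2)[OF assms])
    then show "ipH x (Ts (y - ?Q y)) = ipH x 0"
      unfolding adjoint_pairD[OF pair] by simp
  qed
  then have "Ts (?Q y) = Ts y"
    by (simp add: linear_diff[OF bounded_linear.linear[OF bl_Ts]])
  ultimately show "Cauchy (\<lambda>n. endo_app (r n) (Ts y))" by (simp only:)
qed

text \<open>If \<open>Ts y = s h\<close>, then \<open>r n (Ts y) = r n (s h)\<close> tends to
  \<open>P h\<close>.\<close>

lemma polar_of_range:
  assumes "range Ts \<subseteq> range (endo_app s)"
  shows "\<exists>U. partial_isometry ipH ipK U \<and> T = U \<circ> endo_app s \<and> adj ipH ipK U \<circ> U = P"
proof (rule polar_decomposition)
  fix y
  obtain h where "Ts y = endo_app s h" using assms by auto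
  then show "Cauchy (\<lambda>n. endo_app (r n) (Ts y))"
    using LIMSEQ_imp_Cauchy[OF r_s_limit] by simp
qed

section \<open>Consequences of a given polar decomposition\<close>

context
  fixes U V
  assumes UV: "adjoint_pair ipH ipK U V" and TU: "T = U \<circ> endo_app s" and VU: "V \<circ> U = P"
begin

lemma VU_app: "V (U x) = P x"
  using VU by (auto simp: fun_eq_iff)

lemma U_proj: "U (P x) = U x"
proof -
  have "ipK (U (x - P x)) (U (x - P x)) = ipH (x - P x) (P (x - P x))"
    by (simp add: adjoint_pairD[OF UV] VU_app)
  also have "\<dots> = 0"
    by (rule H.ip_proj_onto_diff(1)[OF compl H.proj_onto_mem[OF compl]])
  finally have "U (x - P x) = 0" by (rule K.ip_self_eq_0)
  then show ?thesis
    by (simp add: linear_diff[OF bounded_linear.linear[OF adjoint_pair_bounded_linear[OF UV]]])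
qed

lemma VT: "V (T x) = endo_app s x"
  by (simp add: TU VU_app H.proj_onto_id[OF compl s_in_M])

lemma Ts_eq: "Ts = endo_app s \<circ> V"
proof -
  have "adjoint_pair ipH ipK T (endo_app s \<circ> V)"
    unfolding TU by (rule adjoint_pair_comp[OF H.endo_adj_imp_adjoint_pair[OF sa_s] UV])
  then show ?thesis using adj_eq pair by metis
qed

text \<open>This is the adjoint of the identity \<open>V T = s\<close>. With \<open>Ts_eq\<close> it
  gives the equality of ranges.\<close>

lemma s_eq: "endo_app s = Ts \<circ> U"
proof
  fix x
  show "endo_app s x = (Ts \<circ> U) x"
  proof (rule H.ip_eqI2)
    fix y
    have "ipH y (endo_app s x) = ipH (V (T y)) x" by (simp add: VT ip_s)
    then show "ipH y (endo_app s x) = ipH y ((Ts \<circ> U) x)"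
      by (simp add: adjoint_pairD[OF pair, symmetric] adjoint_pairD[OF adjoint_pair_sym[OF UV]])
  qed
qed

lemma range_s: "range (endo_app s) = range Ts"
proof
  show "range (endo_app s) \<subseteq> range Ts" by (subst s_eq) auto
  show "range Ts \<subseteq> range (endo_app s)" by (subst Ts_eq) auto
qed

text \<open>The fixed points of \<open>U V\<close> form a closed set containing the range of
  \<open>T\<close>. Conversely a fixed point is \<open>U (P (V y))\<close>, and \<open>U\<close>
  maps limits of the range of \<open>s\<close> to limits of the range of \<open>T\<close>.\<close>

lemma closure_range_T: "closure (range T) = {y. U (V y) = y}"
proof (rule antisym)
  note bl_U = adjoint_pair_bounded_linear[OF UV]
  note bl_V = hilbert_pair.adjoint_pair_bounded_linear[OF swap adjoint_pair_sym[OF UV]]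
  show "closure (range T) \<subseteq> {y. U (V y) = y}"
  proof (rule closure_minimal)
    show "range T \<subseteq> {y. U (V y) = y}" by (auto simp: VT) (simp add: TU)
    show "closed {y. U (V y) = y}"
      by (intro closed_Collect_eq continuous_on_id
          bounded_linear.continuous_on[OF bounded_linear_compose[OF bl_U bl_V]])
  qed
  show "{y. U (V y) = y} \<subseteq> closure (range T)"
  proof
    fix y assume "y \<in> {y. U (V y) = y}"
    then have y: "y = U (P (V y))" by (simp add: U_proj)
    have "U ` closure (range (endo_app s)) \<subseteq> closure (U ` range (endo_app s))"
      by (rule closure_bounded_linear_image_subset[OF bl_U])
    moreover have "U ` range (endo_app s) = range T" by (auto simp: TU)
    moreover have "P (V y) \<in> closure (range (endo_app s))"
      using H.proj_onto_mem[OF compl] closure_range_s by simp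
    ultimately show "y \<in> closure (range T)" using y by auto
  qed
qed

text \<open>\<open>U V\<close> is self-adjoint and idempotent, so
  \<open>y = U (V y) + (y - U (V y))\<close> is an orthogonal splitting.\<close>

lemma complemented_range_T: "orthogonally_complemented actK ipK (closure (range T))"
proof -
  have pUV: "adjoint_pair ipK ipK (U \<circ> V) (U \<circ> V)"
    by (rule adjoint_pair_comp[OF adjoint_pair_sym[OF UV] UV])
  note KK = hilbert_pair.adjoint_pair_act[OF K.hilbert_pair_self pUV]
    hilbert_pair.adjoint_pair_scaleC[OF K.hilbert_pair_self pUV]
    hilbert_pair.adjoint_pair_bounded_linear[OF K.hilbert_pair_self pUV, THEN bounded_linear.linear]
  let ?N = "{y. U (V y) = y}"
  have closed: "closed ?N"
    unfolding closure_range_T[symmetric] by (rule closed_closure)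
  have "closed_submodule actK ?N"
    unfolding closed_submodule_def
    using closed KK(1,2) linear_add[OF KK(3)] linear_0[OF KK(3)] by auto
  moreover have "?N \<inter> orth_compl ipK ?N = {0}"
    using linear_0[OF KK(3)] K.ip_self_eq_0 by (auto simp: orth_compl_def)
  moreover have "\<exists>m\<in>?N. \<exists>n\<in>orth_compl ipK ?N. y = m + n" for y
  proof (intro bexI)
    show "y = U (V y) + (y - U (V y))" by simp
    show "U (V y) \<in> ?N" by (simp add: VU_app U_proj)
    show "y - U (V y) \<in> orth_compl ipK ?N"
      using adjoint_pairD[OF pUV] by (auto simp: orth_compl_def K.ip_diff)
  qed
  ultimately show ?thesis
    unfolding closure_range_T orthogonally_complemented_def by blast
qed

text \<open>\<open>W = U s V = T V\<close> is positive, since a root \<open>e\<close> of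
  \<open>s\<close> writes it as \<open>e V\<close> preceded by its adjoint \<open>U e\<close>. Its
  square is \<open>T V T V = T s V = T Ts\<close>, so \<open>W\<close> is the modulus of the
  adjoint.\<close>

lemma range_abs_adj: "range (abs_adj_op ipH ipK T) = range T"
proof -
  obtain e where e: "H.pos e" "e * e = s" using H.pos_sqrt[OF pos_s] by blast
  have sV: "adjoint_pair ipK ipH (endo_app e \<circ> V) (U \<circ> endo_app e)"
    by (rule adjoint_pair_comp[OF adjoint_pair_sym[OF UV] H.endo_adj_imp_adjoint_pair[OF H.pos_sa[OF e(1)]]])
  define W where "W = endo_of ((U \<circ> endo_app e) \<circ> (endo_app e \<circ> V))"
  have pos_W: "K.pos W"
    unfolding W_def by (rule hilbert_pair.pos_adjoint_comp[OF swap sV])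
  have W: "endo_app W y = T (V y)" for y
    unfolding W_def hilbert_pair.endo_app_adjoint_comp[OF swap sV]
    by (simp add: TU e(2)[symmetric])
  have "endo_app W \<circ> endo_app W = T \<circ> Ts"
    by (simp add: fun_eq_iff W VT Ts_eq)
  then have abs: "abs_adj_op ipH ipK T = endo_app W"
    unfolding abs_adj_op_def adj_eq[OF pair] using K.op_sqrt_eq[OF pos_W] by simp
  \<comment> \<open>\<open>W (U x) = T (P x)\<close>, and \<open>T = U s\<close> does not see the
    kernel part \<open>x - P x\<close>.\<close>
  have "T x = endo_app W (U x)" for x
    by (simp add: W VU_app TU s_proj)
  then show ?thesis unfolding abs using W by (auto simp: image_iff)
qed

end

end

end

theorem theorem3p8:
  fixes actH :: "'h::complex_banach \<Rightarrow> 'a::cstar_algebra \<Rightarrow> 'h"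
    and ipH :: "'h \<Rightarrow> 'h \<Rightarrow> 'a"
    and actK :: "'k::complex_banach \<Rightarrow> 'a \<Rightarrow> 'k"
    and ipK :: "'k \<Rightarrow> 'k \<Rightarrow> 'a"
    and T :: "'h \<Rightarrow> 'k"
  assumes "hilbert_module actH ipH"
    and "hilbert_module actK ipK"
    and "T \<in> adjointable ipH ipK"
  defines "i \<equiv> orthogonally_complemented actK ipK (closure (range T)) \<and>
                orthogonally_complemented actH ipH (closure (range (adj ipH ipK T)))"
    and "ii \<equiv> orthogonally_complemented actH ipH (closure (range (adj ipH ipK T))) \<and>
                (\<exists>U. partial_isometry ipH ipK U \<and> T = U \<circ> abs_op ipH ipK T \<and>
                     adj ipH ipK U \<circ> U = proj_onto ipH (closure (range (adj ipH ipK T))))"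
    and "iii \<equiv> orthogonally_complemented actH ipH (closure (range (adj ipH ipK T))) \<and>
                range (abs_op ipH ipK T) = range (adj ipH ipK T) \<and>
                range (abs_adj_op ipH ipK T) = range T"
  shows "(i \<longleftrightarrow> ii) \<and> (ii \<longleftrightarrow> iii)"
proof -
  interpret hilbert_pair actH ipH actK ipK
    using assms(1,2) by (rule hilbert_pair.intro)
  define Ts where "Ts = adj ipH ipK T"
  have pair: "adjoint_pair ipH ipK T Ts"
    unfolding Ts_def by (rule adjoint_pair_adj[OF assms(3)])
  obtain s where s: "H.pos s" "s * s = endo_of (Ts \<circ> T)"
    using H.pos_sqrt[OF pos_adjoint_comp[OF pair]] by blast
  have ss: "endo_app s (endo_app s x) = Ts (T x)" for x
    using arg_cong[OF s(2), of "\<lambda>f. endo_app f x"] by (simp add: endo_app_adjoint_comp[OF pair])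
  interpret polar actH ipH actK ipK T Ts s
    by unfold_locales (rule pair, rule s(1), rule ss)
  have abs: "abs_op ipH ipK T = endo_app s"
  proof -
    have "adj ipH ipK T \<circ> T = endo_app s \<circ> endo_app s"
      by (simp add: fun_eq_iff ss Ts_def)
    then show ?thesis
      unfolding abs_op_def using H.op_sqrt_eq[OF s(1)] by simp
  qed
  \<comment> \<open>Statement (ii) is the hub: it yields the other two, and each of them yields a
    polar decomposition.\<close>
  have "ii \<Longrightarrow> i \<and> iii"
  proof -
    assume ii
    then obtain U where M: "orthogonally_complemented actH ipH (closure (range Ts))"
      and U: "U \<in> adjointable ipH ipK" "T = U \<circ> endo_app s"
        "adj ipH ipK U \<circ> U = proj_onto ipH (closure (range Ts))"
      unfolding ii_def partial_isometry_def abs Ts_def[symmetric] by blast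
    note facts = M adjoint_pair_adj[OF U(1)] U(2,3)
    show ?thesis
      unfolding i_def iii_def abs Ts_def[symmetric]
      using M complemented_range_T[OF facts] range_s[OF facts] range_abs_adj[OF facts] by blast
  qed
  moreover have "i \<Longrightarrow> ii"
    unfolding i_def ii_def abs Ts_def[symmetric] using polar_of_complemented by blast
  moreover have "iii \<Longrightarrow> ii"
    unfolding iii_def ii_def abs Ts_def[symmetric] using polar_of_range by blast
  ultimately show ?thesis by blast
qed

end
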